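(* Let $\Lambda$ be a finite lattice (a finite set of sites), $N\ge2$ an integer, and let $\mathsf{T}=(t_{x,y})_{x,y\in\Lambda}$ be a Hermitian positive semidefinite matrix ($\mathsf{T}\ge0$) whose kernel $\mathfrak{h}_0=\ker\mathsf{T}\subset\mathbb{C}^{|\Lambda|}$ has dimension $D_0>0$. Let $\mathsf{P}_0$ be the orthogonal projection matrix onto $\mathfrak{h}_0$ and $\Lambda_0=\{x\in\Lambda\mid(\mathsf{P}_0)_{x,x}\ne0\}$. Consider the SU($N$) Kondo lattice Hamiltonian $$\hat H_{\mathrm{KLM}}=\sum_{\alpha=1}^N\sum_{x,y\in\Lambda}t_{x,y}\,\hat c^\dagger_{x,\alpha}\hat c_{y,\alpha}+J_{\mathrm K}\sum_{x\in\Lambda}\sum_{A=1}^{N^2-1}\hat s_x^A\hat S_x^A$$ with ferromagnetic coupling $J_{\mathrm K}<0$, on the space $\mathcal{W}(\Lambda)$ of states with exactly one localized fermion at each site, and with total fermion number $N_{\mathrm{tot}}=D_0+|\Lambda|$. If $\Lambda_0=\Lambda$ and the matrix $\big((\mathsf{P}_0)_{x,y}\big)_{x,y\in\Lambda_0}$ is irreducible, then the model exhibits SU($N$) ferromagnetism.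
   Context: Operators: $\hat c_{x,\alpha}^\dagger,\hat c_{x,\alpha}$ (itinerant fermions) and $\hat f_{x,\alpha}^\dagger,\hat f_{x,\alpha}$ (localized fermions), for $x\in\Lambda$ and color $\alpha=1,\dots,N$, are fermionic creation and annihilation operators: $\{\hat c_{x,\alpha},\hat c^\dagger_{y,\beta}\}=\{\hat f_{x,\alpha},\hat f^\dagger_{y,\beta}\}=\delta_{\alpha,\beta}\delta_{x,y}$, and all other anticommutators (including all those between $c$-type and $f$-type operators) vanish. They act on their Fock space $\mathcal{H}'(\Lambda)$. Number operators: $\hat n^{(c)}_{x,\alpha}=\hat c_{x,\alpha}^\dagger\hat c_{x,\alpha}$, $\hat n^{(f)}_{x,\alpha}=\hat f_{x,\alpha}^\dagger\hat f_{x,\alpha}$, $\hat n^{(f)}_x=\sum_{\alpha}\hat n^{(f)}_{x,\alpha}$. One considers only the subspace $\mathcal{W}(\Lambda)=\{|\Psi\rangle\in\mathcal{H}'(\Lambda)\mid\hat n^{(f)}_x|\Psi\rangle=|\Psi\rangle\text{ for all }x\in\Lambda\}$, which $\hat H_{\mathrm{KLM}}$ preserves. SU($N$) spins: $G^A$ ($A=1,\dots,N^2-1$) are $N\times N$ Hermitian traceless matrices generating SU($N$), normalized by $\mathrm{Tr}(G^AG^B)=\delta_{A,B}$; they satisfy $\sum_{A}(G^A)_{\alpha,\beta}(G^A)_{\mu,\nu}=\delta_{\alpha,\nu}\delta_{\beta,\mu}-\frac1N\delta_{\alpha,\beta}\delta_{\mu,\nu}$. Then $\hat s^A_x=\sum_{\alpha,\beta}\hat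 c^\dagger_{x,\alpha}(G^A)_{\alpha,\beta}\hat c_{x,\beta}$ and $\hat S^A_x=\sum_{\alpha,\beta}\hat f^\dagger_{x,\alpha}(G^A)_{\alpha,\beta}\hat f_{x,\beta}$. Color operators: $\hat F^{\alpha,\beta}_{\mathrm{tot}}=\sum_{x\in\Lambda}(\hat c^\dagger_{x,\alpha}\hat c_{x,\beta}+\hat f^\dagger_{x,\alpha}\hat f_{x,\beta})$ for $\alpha,\beta=1,\dots,N$; $\hat N_{\mathrm{tot}}=\sum_{\alpha=1}^N\hat F^{\alpha,\alpha}_{\mathrm{tot}}$, with eigenvalue $N_{\mathrm{tot}}$ (so in $\mathcal{W}(\Lambda)$, $N_{\mathrm{tot}}=D_0+|\Lambda|$ means that there are $D_0$ itinerant fermions). $\mathcal{H}'_{N_{\mathrm{tot}}}(\Lambda)=\{|\Psi\rangle\in\mathcal{H}'(\Lambda)\mid\hat N_{\mathrm{tot}}|\Psi\rangle=N_{\mathrm{tot}}|\Psi\rangle\}$. Casimir operator: $\hat C_{\mathrm{tot},2}=\frac12\Big(\sum_{\alpha,\beta=1}^N\hat F_{\mathrm{tot}}^{\alpha,\beta}\hat F_{\mathrm{tot}}^{\beta,\alpha}-\frac{\hat N_{\mathrm{tot}}^2}{N}\Big)$. SU($N$) ferromagnetism: the model with fixed $N_{\mathrm{tot}}$ exhibits SU($N$) ferromagnetism if any ground state $|\Psi_{\mathrm{GS}}\rangle$ (any eigenvector with the lowest eigenvalue of $\hat H_{\mathrm{KLM}}$ restricted to $\mathcal{W}(\Lambda)\cap\mathcal{H}'_{N_{\mathrm{tot}}}(\Lambda)$)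 has the maximum eigenvalue of $\hat C_{\mathrm{tot},2}$ in $\mathcal{H}'_{N_{\mathrm{tot}}}(\Lambda)$, i.e. $\hat C_{\mathrm{tot},2}|\Psi_{\mathrm{GS}}\rangle=\frac{N_{\mathrm{tot}}(N-1)}{2}\left(\frac{N_{\mathrm{tot}}}{N}+1\right)|\Psi_{\mathrm{GS}}\rangle$. Irreducibility: the matrix $((\mathsf{P}_0)_{x,y})_{x,y\in\Lambda_0}$ is reducible if and only if $\Lambda_0=\Lambda_1\cup\Lambda_2$ for some disjoint nonempty $\Lambda_1,\Lambda_2$ with $(\mathsf{P}_0)_{x,y}=0$ for any $x\in\Lambda_1$, $y\in\Lambda_2$; it is irreducible if it is not reducible. *)

theory Defs
  imports "HOL-Analysis.Analysis" "HOL-Library.Countable"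
begin

section \<open>Complex matrices\<close>

text \<open>The standard inner product of \<open>\<complex>\<^sup>n\<close>; the library inner product on
  \<^typ>\<open>complex^'n\<close> is only its real part.\<close>

definition cinner :: "complex^'n \<Rightarrow> complex^'n \<Rightarrow> complex" where
  "cinner v w = (\<Sum>i\<in>UNIV. cnj (v $ i) * w $ i)"

definition hermitian :: "complex^'n^'n \<Rightarrow> bool" where
  "hermitian A \<longleftrightarrow> (\<forall>i j. A $ i $ j = cnj (A $ j $ i))"

definition pos_semidef :: "complex^'n^'n \<Rightarrow> bool" where
  "pos_semidef A \<longleftrightarrow> hermitian A \<and> (\<forall>v. 0 \<le> Re (cinner v (A *v v)))"

definition mat_ker :: "complex^'n^'n \<Rightarrow> (complex^'n) set" where
  "mat_ker A = {v. A *v v = 0}"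

definition orth_projection_onto :: "complex^'n^'n \<Rightarrow> (complex^'n) set \<Rightarrow> bool" where
  "orth_projection_onto P V \<longleftrightarrow> hermitian P \<and> P ** P = P \<and> range (\<lambda>v. P *v v) = V"

definition diag_support :: "complex^'v^'v \<Rightarrow> 'v set" where
  "diag_support P = {x. P $ x $ x \<noteq> 0}"

definition reducible_on :: "complex^'v^'v \<Rightarrow> 'v set \<Rightarrow> bool" where
  "reducible_on P S \<longleftrightarrow>
     (\<exists>S1 S2. S = S1 \<union> S2 \<and> S1 \<inter> S2 = {} \<and> S1 \<noteq> {} \<and> S2 \<noteq> {} \<and>
        (\<forall>x\<in>S1. \<forall>y\<in>S2. P $ x $ y = 0))"

definition irreducible_on :: "complex^'v^'v \<Rightarrow> 'v set \<Rightarrow> bool" where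
  "irreducible_on P S \<longleftrightarrow> \<not> reducible_on P S"


section \<open>Fermionic Fock space over a finite set of modes\<close>

text \<open>A state assigns an amplitude to each set of occupied modes. The occupation-number basis
  vector of a set \<open>S\<close> is the product of the creation operators of the modes in \<open>S\<close>, in
  increasing order of the (arbitrary) enumeration \<^const>\<open>to_nat\<close>, applied to the vacuum.
  The sign \<open>jw_sign\<close> results from moving an operator of mode \<open>m\<close> to its place in this product.\<close>

type_synonym 'm fock = "complex^('m set)"

definition jw_sign :: "'m::finite \<Rightarrow> 'm set \<Rightarrow> complex" where
  "jw_sign m S = (- 1) ^ card {k \<in> S. to_nat k < to_nat m}"

definition create :: "'m::finite \<Rightarrow> 'm fock \<Rightarrow> 'm fock" where
  "create m \<psi> = (\<chi> S. if m \<in> S then jw_sign m S * \<psi> $ (S - {m}) else 0)"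

definition annih :: "'m::finite \<Rightarrow> 'm fock \<Rightarrow> 'm fock" where
  "annih m \<psi> = (\<chi> S. if m \<in> S then 0 else jw_sign m S * \<psi> $ (insert m S))"

text \<open>Sanity checks: the canonical anticommutation relations and mutual adjointness.\<close>

lemma jw_sign_square [simp]: "jw_sign m S * jw_sign m S = 1"
  by (simp add: jw_sign_def flip: power_add power_mult_distrib)

lemma jw_sign_insert:
  assumes "k \<notin> S"
  shows "jw_sign m (insert k S) = (if to_nat k < to_nat m then - jw_sign m S else jw_sign m S)"
proof (cases "to_nat k < to_nat m")
  case True
  then have "{j \<in> insert k S. to_nat j < to_nat m} = insert k {j \<in> S. to_nat j < to_nat m}"
    by auto
  then show ?thesis using True assms by (simp add: jw_sign_def)
next
  case False
  then have "{j \<in> insert k S. to_nat j < to_nat m} = {j \<in> S. to_nat j < to_nat m}"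
    by auto
  then show ?thesis using False by (simp add: jw_sign_def)
qed

lemma jw_sign_remove:
  assumes "k \<in> S"
  shows "jw_sign m (S - {k}) = (if to_nat k < to_nat m then - jw_sign m S else jw_sign m S)"
  using jw_sign_insert[of k "S - {k}" m] assms by (auto simp: insert_absorb)

lemma to_nat_cases:
  assumes "m \<noteq> k"
  obtains "to_nat m < to_nat k" "\<not> to_nat k < to_nat m"
        | "to_nat k < to_nat m" "\<not> to_nat m < to_nat k"
  using assms by (metis inj_to_nat injD less_asym linorder_neqE_nat)

lemma annih_create:
  "annih m (create k \<psi>) + create k (annih m \<psi>) = (if m = k then \<psi> else 0)"
proof (cases "m = k")
  case True
  show ?thesis
    by (auto simp: True vec_eq_iff annih_def create_def jw_sign_insert jw_sign_remove insert_absorb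
        simp flip: mult.assoc)
next
  case False
  show ?thesis
    by (rule to_nat_cases[OF False])
       (use False in \<open>auto simp: vec_eq_iff annih_def create_def jw_sign_insert jw_sign_remove
          insert_Diff_if\<close>)
qed

lemma annih_annih: "annih m (annih k \<psi>) + annih k (annih m \<psi>) = 0"
proof (cases "m = k")
  case True
  then show ?thesis by (auto simp: vec_eq_iff annih_def)
next
  case False
  show ?thesis
    by (rule to_nat_cases[OF False])
       (use False in \<open>auto simp: vec_eq_iff annih_def jw_sign_insert insert_commute\<close>)
qed

lemma create_create: "create m (create k \<psi>) + create k (create m \<psi>) = 0"
proof (cases "m = k")
  case True
  then show ?thesis by (auto simp: vec_eq_iff create_def)
next
  case False
  have swap: "S - {m} - {k} = S - {k} - {m}" for S by auto
  show ?thesis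
    by (rule to_nat_cases[OF False])
       (use False in \<open>simp_all add: vec_eq_iff create_def jw_sign_remove swap\<close>)
qed

lemma cnj_jw_sign [simp]: "cnj (jw_sign m S) = jw_sign m S"
  by (simp add: jw_sign_def)

lemma cinner_create: "cinner (create m \<phi>) \<psi> = cinner \<phi> (annih m \<psi>)"
proof -
  have "cinner (create m \<phi>) \<psi>
      = (\<Sum>S | m \<in> S. jw_sign m S * cnj (\<phi> $ (S - {m})) * \<psi> $ S)"
    by (auto simp: cinner_def create_def intro!: sum.mono_neutral_cong_right split: if_splits)
  also have "\<dots> = (\<Sum>S | m \<notin> S. cnj (\<phi> $ S) * (jw_sign m S * \<psi> $ insert m S))"
    by (rule sum.reindex_bij_witness[of _ "insert m" "\<lambda>S. S - {m}"])
       (auto simp: insert_absorb jw_sign_remove)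
  also have "\<dots> = cinner \<phi> (annih m \<psi>)"
    by (auto simp: cinner_def annih_def intro!: sum.mono_neutral_cong_left split: if_splits)
  finally show ?thesis .
qed


section \<open>Spectral notions for operators restricted to a subspace\<close>

text \<open>These are used for self-adjoint operators only, so real eigenvalues suffice.\<close>

definition eigvec_in :: "('m::finite fock \<Rightarrow> 'm fock) \<Rightarrow> 'm fock set \<Rightarrow> real \<Rightarrow> 'm fock \<Rightarrow> bool" where
  "eigvec_in A V e \<psi> \<longleftrightarrow> \<psi> \<in> V \<and> \<psi> \<noteq> 0 \<and> A \<psi> = complex_of_real e *s \<psi>"

definition lowest_eigval_in :: "('m::finite fock \<Rightarrow> 'm fock) \<Rightarrow> 'm fock set \<Rightarrow> real \<Rightarrow> bool" where
  "lowest_eigval_in A V e \<longleftrightarrow>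
     (\<exists>\<psi>. eigvec_in A V e \<psi>) \<and> (\<forall>e' \<psi>. eigvec_in A V e' \<psi> \<longrightarrow> e \<le> e')"

definition highest_eigval_in :: "('m::finite fock \<Rightarrow> 'm fock) \<Rightarrow> 'm fock set \<Rightarrow> real \<Rightarrow> bool" where
  "highest_eigval_in A V e \<longleftrightarrow>
     (\<exists>\<psi>. eigvec_in A V e \<psi>) \<and> (\<forall>e' \<psi>. eigvec_in A V e' \<psi> \<longrightarrow> e' \<le> e)"


section \<open>The SU(N) Kondo lattice model\<close>

text \<open>Sites are the elements of \<open>'v\<close> and colors those of \<open>'n\<close>, so \<open>N = CARD('n)\<close>.
  The modes \<open>Inl (x, \<alpha>)\<close> are itinerant, the modes \<open>Inr (x, \<alpha>)\<close> localized.\<close>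

type_synonym ('v, 'n) mode = "('v \<times> 'n) + ('v \<times> 'n)"

type_synonym ('v, 'n) kstate = "('v, 'n) mode fock"

type_synonym ('v, 'n) kop = "('v, 'n) kstate \<Rightarrow> ('v, 'n) kstate"

definition cdag :: "'v::finite \<Rightarrow> 'n::finite \<Rightarrow> ('v, 'n) kop" where
  "cdag x \<alpha> = create (Inl (x, \<alpha>))"

definition cop :: "'v::finite \<Rightarrow> 'n::finite \<Rightarrow> ('v, 'n) kop" where
  "cop x \<alpha> = annih (Inl (x, \<alpha>))"

definition fdag :: "'v::finite \<Rightarrow> 'n::finite \<Rightarrow> ('v, 'n) kop" where
  "fdag x \<alpha> = create (Inr (x, \<alpha>))"

definition fop :: "'v::finite \<Rightarrow> 'n::finite \<Rightarrow> ('v, 'n) kop" where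
  "fop x \<alpha> = annih (Inr (x, \<alpha>))"

definition nf_op :: "'v::finite \<Rightarrow> ('v, 'n::finite) kop" where
  "nf_op x \<psi> = (\<Sum>\<alpha>\<in>UNIV. fdag x \<alpha> (fop x \<alpha> \<psi>))"

definition W_space :: "('v::finite, 'n::finite) kstate set" where
  "W_space = {\<psi>. \<forall>x. nf_op x \<psi> = \<psi>}"

text \<open>The \<open>N\<^sup>2 - 1\<close> orthonormal generators, indexed from 1. That they span the traceless
  matrices and satisfy the completeness relation (\<open>su_generators_complete\<close> below) is a
  consequence of their number.\<close>

definition su_generators :: "(nat \<Rightarrow> complex^'n^'n) \<Rightarrow> bool" where
  "su_generators G \<longleftrightarrow>
     (\<forall>A\<in>{1..CARD('n)^2 - 1}. hermitian (G A) \<and> trace (G A) = 0) \<and>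
     (\<forall>A\<in>{1..CARD('n)^2 - 1}. \<forall>B\<in>{1..CARD('n)^2 - 1}.
        trace (G A ** G B) = (if A = B then 1 else 0))"

lemma su_generators_complete:
  fixes G :: "nat \<Rightarrow> complex^'n^'n"
  assumes "su_generators G"
  shows "(\<Sum>A = 1..CARD('n)^2 - 1. G A $ \<alpha> $ \<beta> * G A $ \<mu> $ \<nu>) =
    (if \<alpha> = \<nu> \<and> \<beta> = \<mu> then 1 else 0) - (if \<alpha> = \<beta> \<and> \<mu> = \<nu> then 1 / of_nat CARD('n) else 0)"
proof -
  let ?N = "CARD('n)"
  define r where "r = complex_of_real (1 / sqrt (real ?N))"
  have r2: "r * r = 1 / of_nat ?N"
    by (simp add: r_def flip: of_real_mult)
  then have r2': "of_nat ?N * (r * r) = 1"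
    by simp
  define E where "E A = (if A = 0 then mat r else G A)" for A
  have matr: "mat r ** B = (\<chi> i j. r * B $ i $ j)" "B ** mat r = (\<chi> i j. r * B $ i $ j)"
    for B :: "complex^'n^'n"
  proof -
    have "(\<Sum>k\<in>UNIV. (if i = k then r else 0) * B $ k $ j) = r * B $ i $ j"
         "(\<Sum>k\<in>UNIV. B $ i $ k * (if k = j then r else 0)) = r * B $ i $ j" for i j
      by (simp_all add: if_distrib[of "\<lambda>a. a * _"] if_distrib[of "\<lambda>a. _ * a"] mult.commute
          cong: if_cong)
    then show "mat r ** B = (\<chi> i j. r * B $ i $ j)" "B ** mat r = (\<chi> i j. r * B $ i $ j)"
      by (simp_all add: matrix_matrix_mult_def mat_def)
  qed
  have trE: "trace (E A ** E B) = (if A = B then 1 else 0)" if "A < ?N^2" "B < ?N^2" for A B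
  proof -
    have G0: "A \<noteq> 0 \<Longrightarrow> trace (G A) = 0" "B \<noteq> 0 \<Longrightarrow> trace (G B) = 0"
      and GG: "A \<noteq> 0 \<Longrightarrow> B \<noteq> 0 \<Longrightarrow> trace (G A ** G B) = (if A = B then 1 else 0)"
      using that assms by (auto simp: su_generators_def)
    have "trace (\<chi> i j. r * B $ i $ j) = r * trace B" for B :: "complex^'n^'n"
      by (simp add: trace_def sum_distrib_left)
    then show ?thesis
      using G0 GG r2' by (auto simp: E_def matr) (simp add: trace_def mat_def mult.left_commute)
  qed
  have "card (UNIV :: ('n \<times> 'n) set) = card {0..<?N^2}"
    by (simp add: power2_eq_square)
  then obtain h :: "'n \<times> 'n \<Rightarrow> nat" where h: "bij_betw h UNIV {0..<?N^2}"
    using finite_same_card_bij finite_code finite_atLeastLessThan by metis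
  have hlt: "h p < ?N^2" for p using h by (auto simp: bij_betw_def)
  have heq: "h p = h q \<longleftrightarrow> p = q" for p q using h by (auto simp: bij_betw_def inj_eq)
  define U where "U = (\<chi> p q. E (h p) $ fst q $ snd q)"
  define V where "V = (\<chi> q p. E (h p) $ snd q $ fst q)"
  have "U ** V = mat 1"
  proof -
    have "(U ** V) $ p $ q = trace (E (h p) ** E (h q))" for p q
      by (simp add: matrix_matrix_mult_def U_def V_def trace_def sum.cartesian_product
          case_prod_beta UNIV_Times_UNIV)
    then show ?thesis by (simp add: vec_eq_iff mat_def trE hlt heq)
  qed
  then have VU: "V ** U = mat 1" by (simp add: matrix_left_right_inverse)
  have "(\<Sum>A<?N^2. E A $ \<alpha> $ \<beta> * E A $ \<mu> $ \<nu>) = (\<Sum>p\<in>UNIV. E (h p) $ \<alpha> $ \<beta> * E (h p) $ \<mu> $ \<nu>)"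
    using sum.reindex_bij_betw[OF h, of "\<lambda>A. E A $ \<alpha> $ \<beta> * E A $ \<mu> $ \<nu>"]
    by (simp add: lessThan_atLeast0)
  also have "\<dots> = (V ** U) $ (\<beta>, \<alpha>) $ (\<mu>, \<nu>)"
    by (simp add: matrix_matrix_mult_def U_def V_def)
  also have "\<dots> = (if \<alpha> = \<nu> \<and> \<beta> = \<mu> then 1 else 0)"
    by (auto simp: VU mat_def)
  finally have "(\<Sum>A<?N^2. E A $ \<alpha> $ \<beta> * E A $ \<mu> $ \<nu>) = (if \<alpha> = \<nu> \<and> \<beta> = \<mu> then 1 else 0)" .
  moreover have "{..<?N^2} = insert 0 {1..?N^2 - 1}"
    by auto
  ultimately have "E 0 $ \<alpha> $ \<beta> * E 0 $ \<mu> $ \<nu> + (\<Sum>A = 1..?N^2 - 1. E A $ \<alpha> $ \<beta> * E A $ \<mu> $ \<nu>)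
      = (if \<alpha> = \<nu> \<and> \<beta> = \<mu> then 1 else 0)"
    by simp
  moreover have "(\<Sum>A = 1..?N^2 - 1. E A $ \<alpha> $ \<beta> * E A $ \<mu> $ \<nu>)
      = (\<Sum>A = 1..?N^2 - 1. G A $ \<alpha> $ \<beta> * G A $ \<mu> $ \<nu>)"
    by (intro sum.cong) (auto simp: E_def)
  moreover have "E 0 $ \<alpha> $ \<beta> * E 0 $ \<mu> $ \<nu> = (if \<alpha> = \<beta> \<and> \<mu> = \<nu> then 1 / of_nat ?N else 0)"
    by (auto simp: E_def mat_def r2)
  ultimately show ?thesis by (simp add: algebra_simps)
qed

definition s_op :: "(nat \<Rightarrow> complex^'n^'n) \<Rightarrow> nat \<Rightarrow> 'v::finite \<Rightarrow> ('v, 'n::finite) kop" where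
  "s_op G A x \<psi> = (\<Sum>\<alpha>\<in>UNIV. \<Sum>\<beta>\<in>UNIV. (G A $ \<alpha> $ \<beta>) *s cdag x \<alpha> (cop x \<beta> \<psi>))"

definition S_op :: "(nat \<Rightarrow> complex^'n^'n) \<Rightarrow> nat \<Rightarrow> 'v::finite \<Rightarrow> ('v, 'n::finite) kop" where
  "S_op G A x \<psi> = (\<Sum>\<alpha>\<in>UNIV. \<Sum>\<beta>\<in>UNIV. (G A $ \<alpha> $ \<beta>) *s fdag x \<alpha> (fop x \<beta> \<psi>))"

definition H_KLM ::
  "complex^'v^'v \<Rightarrow> real \<Rightarrow> (nat \<Rightarrow> complex^'n^'n) \<Rightarrow> ('v::finite, 'n::finite) kop" where
  "H_KLM T J G \<psi> =
     (\<Sum>\<alpha>\<in>UNIV. \<Sum>x\<in>UNIV. \<Sum>y\<in>UNIV. (T $ x $ y) *s cdag x \<alpha> (cop y \<alpha> \<psi>))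
     + complex_of_real J *s (\<Sum>x\<in>UNIV. \<Sum>A = 1..CARD('n)^2 - 1. s_op G A x (S_op G A x \<psi>))"

definition F_tot :: "'n::finite \<Rightarrow> 'n \<Rightarrow> ('v::finite, 'n) kop" where
  "F_tot \<alpha> \<beta> \<psi> = (\<Sum>x\<in>UNIV. cdag x \<alpha> (cop x \<beta> \<psi>) + fdag x \<alpha> (fop x \<beta> \<psi>))"

definition N_tot :: "('v::finite, 'n::finite) kop" where
  "N_tot \<psi> = (\<Sum>\<alpha>\<in>UNIV. F_tot \<alpha> \<alpha> \<psi>)"

definition H_space :: "nat \<Rightarrow> ('v::finite, 'n::finite) kstate set" where
  "H_space n = {\<psi>. N_tot \<psi> = of_nat n *s \<psi>}"

definition casimir_tot :: "('v::finite, 'n::finite) kop" where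
  "casimir_tot \<psi> = (1 / 2) *s
     ((\<Sum>\<alpha>\<in>UNIV. \<Sum>\<beta>\<in>UNIV. F_tot \<alpha> \<beta> (F_tot \<beta> \<alpha> \<psi>))
      - (1 / of_nat CARD('n)) *s N_tot (N_tot \<psi>))"

definition ground_state ::
  "complex^'v^'v \<Rightarrow> real \<Rightarrow> (nat \<Rightarrow> complex^'n^'n) \<Rightarrow> nat \<Rightarrow> ('v::finite, 'n::finite) kstate \<Rightarrow> bool"
  where
  "ground_state T J G n \<psi> \<longleftrightarrow>
     (\<exists>e. lowest_eigval_in (H_KLM T J G) (W_space \<inter> H_space n) e \<and>
          eigvec_in (H_KLM T J G) (W_space \<inter> H_space n) e \<psi>)"

definition max_casimir :: "nat \<Rightarrow> nat \<Rightarrow> real" where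
  "max_casimir N n = real n * (real N - 1) / 2 * (real n / real N + 1)"

text \<open>Every ground state attains the highest eigenvalue of the Casimir operator among all states
  with \<open>n\<close> fermions, and this eigenvalue is \<open>max_casimir N n\<close>.\<close>

definition su_ferromagnetism ::
  "complex^'v::finite^'v \<Rightarrow> real \<Rightarrow> (nat \<Rightarrow> complex^'n::finite^'n) \<Rightarrow> nat \<Rightarrow> bool" where
  "su_ferromagnetism T J G n \<longleftrightarrow>
     (\<forall>\<psi> :: ('v, 'n) kstate. ground_state T J G n \<psi> \<longrightarrow>
        highest_eigval_in (casimir_tot :: ('v, 'n) kop) (H_space n) (max_casimir CARD('n) n) \<and>
        casimir_tot \<psi> = complex_of_real (max_casimir CARD('n) n) *s \<psi>)"

end

theory Submission
  imports Defs
begin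

text \<open>On states with one localized fermion per site, the Kondo coupling equals
  \<open>J (1 - 1/N)\<close> times the number of itinerant fermions plus \<open>|J|/2\<close> times a sum of squares
  of the operators \<open>c\<^sub>\<alpha> f\<^sub>\<beta> - c\<^sub>\<beta> f\<^sub>\<alpha>\<close> at each site over all ordered pairs of colors,
  and the hopping term is positive semidefinite.
  A fully polarized state with the kernel of \<open>T\<close> filled shows that the resulting lower bound
  is attained, so every ground state \<open>\<psi>\<close> has all itinerant fermions in \<open>ker T\<close> and is annihilated by
  all those operators.

  The local condition forces \<open>c\<^sub>\<alpha> c\<^sub>\<beta> \<psi> = 0\<close> at each site. In a basis of \<open>ker T\<close> dual to the
  evaluations at \<open>D0\<close> sites, each basis vector then carries exactly one fermion. Expanding
  the two conditions at a site \<open>x\<close> in this basis and using independence of the terms, any two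
  basis vectors overlapping at \<open>x\<close>, and any basis vector not vanishing at \<open>x\<close> and
  the localized fermion at \<open>x\<close>, are symmetric under exchange of colors. Transpositions compose, so
  irreducibility makes \<open>\<psi>\<close> symmetric in all colors, which means that the Casimir operator is maximal.\<close>

section \<open>Fock space algebra\<close>

lemma annih_add: "annih m (\<phi> + \<psi>) = annih m \<phi> + annih m \<psi>"
  by (simp add: vec_eq_iff annih_def algebra_simps)

lemma annih_diff: "annih m (\<phi> - \<psi>) = annih m \<phi> - annih m \<psi>"
  by (simp add: vec_eq_iff annih_def algebra_simps)

lemma annih_scale: "annih m (a *s \<psi>) = a *s annih m \<psi>"
  by (simp add: vec_eq_iff annih_def algebra_simps)

lemma annih_zero [simp]: "annih m 0 = 0"
  by (simp add: vec_eq_iff annih_def)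

lemma annih_minus: "annih m (- \<psi>) = - annih m \<psi>"
  by (simp add: vec_eq_iff annih_def)

lemma annih_sum: "annih m (\<Sum>i\<in>X. f i) = (\<Sum>i\<in>X. annih m (f i))"
  by (induction X rule: infinite_finite_induct) (simp_all add: annih_add)

lemma create_add: "create m (\<phi> + \<psi>) = create m \<phi> + create m \<psi>"
  by (simp add: vec_eq_iff create_def algebra_simps)

lemma create_diff: "create m (\<phi> - \<psi>) = create m \<phi> - create m \<psi>"
  by (simp add: vec_eq_iff create_def algebra_simps)

lemma create_scale: "create m (a *s \<psi>) = a *s create m \<psi>"
  by (simp add: vec_eq_iff create_def algebra_simps)

lemma create_zero [simp]: "create m 0 = 0"
  by (simp add: vec_eq_iff create_def)

lemma create_minus: "create m (- \<psi>) = - create m \<psi>"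
  by (simp add: vec_eq_iff create_def)

lemma create_sum: "create m (\<Sum>i\<in>X. f i) = (\<Sum>i\<in>X. create m (f i))"
  by (induction X rule: infinite_finite_induct) (simp_all add: create_add)

lemmas fock_linear =
  annih_add annih_diff annih_scale annih_minus annih_sum
  create_add create_diff create_scale create_minus create_sum

lemma annih_swap: "annih m (annih k \<psi>) = - annih k (annih m \<psi>)"
  using annih_annih[of m k \<psi>] by (simp add: eq_neg_iff_add_eq_0)

lemma create_swap: "create m (create k \<psi>) = - create k (create m \<psi>)"
  using create_create[of m k \<psi>] by (simp add: eq_neg_iff_add_eq_0)

lemma annih_create_eq:
  "annih m (create k \<psi>) = (if m = k then \<psi> else 0) - create k (annih m \<psi>)"
  using annih_create[of m k \<psi>] by (simp add: eq_diff_eq)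

text \<open>The two signs coincide, since \<open>m\<close> is not counted among the modes below
  \<open>m\<close>, so their product is 1.\<close>

lemma create_annih_nth: "create m (annih m \<psi>) $ S = (if m \<in> S then \<psi> $ S else 0)"
  by (auto simp: create_def annih_def jw_sign_remove insert_absorb simp flip: mult.assoc)

lemma scale_sum: "a *s (\<Sum>i\<in>X. f i) = (\<Sum>i\<in>X. a *s f i)" for f :: "'i \<Rightarrow> complex^'k"
  by (rule vec.scale_sum_right)

section \<open>Sesquilinearity and definiteness of the inner product\<close>

lemma cinner_add_right: "cinner u (v + w) = cinner u v + cinner u w"
  by (simp add: cinner_def algebra_simps sum.distrib)

lemma cinner_add_left: "cinner (u + v) w = cinner u w + cinner v w"
  by (simp add: cinner_def algebra_simps sum.distrib)

lemma cinner_diff_left: "cinner (u - v) w = cinner u w - cinner v w"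
  by (simp add: cinner_def algebra_simps sum_subtractf)

lemma cinner_diff_right: "cinner u (v - w) = cinner u v - cinner u w"
  by (simp add: cinner_def algebra_simps sum_subtractf)

lemma cinner_minus_left: "cinner (- u) w = - cinner u w"
  by (simp add: cinner_def sum_negf)

lemma cinner_minus_right: "cinner u (- w) = - cinner u w"
  by (simp add: cinner_def sum_negf)

lemma cinner_scale_right: "cinner u (a *s v) = a * cinner u v"
  by (simp add: cinner_def algebra_simps sum_distrib_left)

lemma cinner_scale_left: "cinner (a *s u) v = cnj a * cinner u v"
  by (simp add: cinner_def algebra_simps sum_distrib_left)

lemma cinner_zero_right [simp]: "cinner u 0 = 0"
  by (simp add: cinner_def)

lemma cinner_zero_left [simp]: "cinner 0 u = 0"
  by (simp add: cinner_def)

lemma cinner_sum_right: "cinner u (\<Sum>i\<in>X. f i) = (\<Sum>i\<in>X. cinner u (f i))"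
  by (induction X rule: infinite_finite_induct) (simp_all add: cinner_add_right)

lemma cinner_sum_left: "cinner (\<Sum>i\<in>X. f i) u = (\<Sum>i\<in>X. cinner (f i) u)"
  by (induction X rule: infinite_finite_induct) (simp_all add: cinner_add_left)

lemma cinner_commute: "cinner u v = cnj (cinner v u)"
  by (simp add: cinner_def mult.commute)

lemma cinner_self: "cinner v v = complex_of_real (\<Sum>i\<in>UNIV. (cmod (v $ i))\<^sup>2)"
  by (simp add: cinner_def mult.commute[of "cnj _"] flip: complex_norm_square)

lemma cinner_self_nonneg: "0 \<le> Re (cinner v v)"
  by (simp add: cinner_self sum_nonneg)

lemma cinner_self_eq_0: "Re (cinner v v) = 0 \<longleftrightarrow> v = 0"
  by (simp add: cinner_self sum_nonneg_eq_0_iff vec_eq_iff)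

lemma cinner_annih: "cinner (annih m \<phi>) \<psi> = cinner \<phi> (create m \<psi>)"
  by (metis cinner_commute cinner_create)

section \<open>Number operators of sets of modes\<close>

definition num_op :: "'m::finite set \<Rightarrow> 'm fock \<Rightarrow> 'm fock" where
  "num_op M \<psi> = (\<Sum>m\<in>M. create m (annih m \<psi>))"

lemma num_op_annih:
  fixes M :: "'m::finite set"
  shows "num_op M (annih k \<psi>) = annih k (num_op M \<psi>) - (if k \<in> M then annih k \<psi> else 0)"
proof -
  have "create m (annih m (annih k \<psi>))
      = annih k (create m (annih m \<psi>)) - (if m = k then annih k \<psi> else 0)" for m
    by (auto simp: annih_swap[of m k] annih_create_eq create_minus)
  then show ?thesis
    by (simp add: num_op_def annih_sum sum_subtractf)
qed

lemma num_op_create: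
  fixes M :: "'m::finite set"
  shows "num_op M (create k \<psi>) = create k (num_op M \<psi>) + (if k \<in> M then create k \<psi> else 0)"
proof -
  have "create m (annih m (create k \<psi>))
      = create k (create m (annih m \<psi>)) + (if m = k then create k \<psi> else 0)" for m
    by (auto simp: annih_create_eq create_diff create_swap[of m k])
  then show ?thesis
    by (simp add: num_op_def create_sum sum.distrib)
qed

lemma num_op_diff: "num_op M (\<phi> - \<psi>) = num_op M \<phi> - num_op M \<psi>"
  by (simp add: num_op_def fock_linear sum_subtractf)

lemma num_op_scale: "num_op M (a *s \<psi>) = a *s num_op M \<psi>"
  by (simp add: num_op_def fock_linear scale_sum)

lemma num_op_sum: "num_op M (\<Sum>i\<in>X. f i) = (\<Sum>i\<in>X. num_op M (f i))"
  by (simp add: num_op_def fock_linear) (rule sum.swap)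

text \<open>The expectation of \<open>num_op M\<close> is the sum of the squared norms of
  \<open>annih m \<psi>\<close> over \<open>M\<close>, so each of them vanishes.\<close>

lemma num_op_eq_0D:
  fixes M :: "'m::finite set"
  assumes "num_op M \<psi> = 0" "m \<in> M"
  shows "annih m \<psi> = 0"
proof -
  have "0 = Re (cinner \<psi> (num_op M \<psi>))"
    using assms by simp
  also have "\<dots> = (\<Sum>m\<in>M. Re (cinner (annih m \<psi>) (annih m \<psi>)))"
    by (simp add: num_op_def cinner_sum_right cinner_annih)
  finally have "Re (cinner (annih m \<psi>) (annih m \<psi>)) = 0"
    using assms(2) by (metis (no_types, lifting) cinner_self_nonneg finite sum_nonneg_eq_0_iff)
  then show ?thesis
    by (simp add: cinner_self_eq_0)
qed

section \<open>Color exchange of two particles\<close>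

text \<open>\<open>a\<close> and \<open>b\<close> send a color to a mode and stand for two particle
  positions, itinerant or localized. Up to a factor this is the color-antisymmetric part of the
  two-particle amplitude, so exchange symmetry is expressed without a permutation operator.\<close>

definition swap_defect ::
    "('n \<Rightarrow> 'm::finite) \<Rightarrow> ('n \<Rightarrow> 'm) \<Rightarrow> 'n \<Rightarrow> 'n \<Rightarrow> 'm fock \<Rightarrow> 'm fock" where
  "swap_defect a b \<alpha> \<beta> \<psi> = annih (a \<alpha>) (annih (b \<beta>) \<psi>) - annih (a \<beta>) (annih (b \<alpha>) \<psi>)"

definition swap_sym :: "('n \<Rightarrow> 'm::finite) \<Rightarrow> ('n \<Rightarrow> 'm) \<Rightarrow> 'm fock \<Rightarrow> bool" where
  "swap_sym a b \<psi> \<longleftrightarrow> (\<forall>\<alpha> \<beta>. swap_defect a b \<alpha> \<beta> \<psi> = 0)"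

lemma swap_symD:
  "swap_sym a b \<psi> \<Longrightarrow> annih (a \<alpha>) (annih (b \<beta>) \<psi>) = annih (a \<beta>) (annih (b \<alpha>) \<psi>)"
  by (simp add: swap_sym_def swap_defect_def)

lemma swap_defect_commute: "swap_defect b a \<alpha> \<beta> \<psi> = swap_defect a b \<alpha> \<beta> \<psi>"
  unfolding swap_defect_def annih_swap[of "b _" "a _"] by simp

lemma swap_sym_commute: "swap_sym b a \<psi> \<longleftrightarrow> swap_sym a b \<psi>"
  by (simp add: swap_sym_def swap_defect_commute[of b a])

lemma annih_pair_swap: "annih k (annih m (annih l \<psi>)) = annih m (annih l (annih k \<psi>))"
  by (simp add: annih_swap[of k m] annih_swap[of k l] annih_minus)

text \<open>The transpositions of the particles \<open>(a, b)\<close> and \<open>(b, c)\<close> generate that of \<open>(a, c)\<close>, but only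
  on states in which \<open>b\<close> is present, hence the extra annihilation operator.\<close>

lemma swap_defect_bridge:
  assumes ab: "swap_sym a b \<psi>" and bc: "swap_sym b c \<psi>"
  shows "annih (b \<gamma>) (swap_defect a c \<alpha> \<beta> \<psi>) = 0"
proof -
  have bc': "annih (b \<gamma>) (annih (a \<alpha>) (annih (c \<beta>) \<psi>)) = annih (b \<beta>) (annih (a \<alpha>) (annih (c \<gamma>) \<psi>))"
    for \<alpha> \<beta> \<gamma>
    unfolding annih_swap[of "b _" "a _"] swap_symD[OF bc, of \<gamma> \<beta>] ..
  have ab': "annih (b \<gamma>) (annih (a \<alpha>) (annih (c \<beta>) \<psi>)) = annih (b \<alpha>) (annih (a \<gamma>) (annih (c \<beta>) \<psi>))"
    for \<alpha> \<beta> \<gamma>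
    using swap_symD[OF ab, of \<alpha> \<gamma>]
    by (simp add: annih_swap[of "b _" "a _"] flip: annih_pair_swap[of "c \<beta>"])
  \<comment> \<open>The transposition of \<open>a\<close> and \<open>c\<close> is written as the
    product of those of \<open>a\<close>, \<open>b\<close>, then \<open>b\<close>, \<open>c\<close>,
    then \<open>a\<close>, \<open>b\<close>.\<close>
  have "annih (b \<gamma>) (annih (a \<alpha>) (annih (c \<beta>) \<psi>)) = annih (b \<alpha>) (annih (a \<gamma>) (annih (c \<beta>) \<psi>))"
    by (rule ab')
  also have "\<dots> = annih (b \<beta>) (annih (a \<gamma>) (annih (c \<alpha>) \<psi>))"
    by (rule bc')
  also have "\<dots> = annih (b \<gamma>) (annih (a \<beta>) (annih (c \<alpha>) \<psi>))"
    by (rule ab')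
  finally show ?thesis
    by (simp add: swap_defect_def annih_diff)
qed

text \<open>Moving the creation operators to the left factor reverses their order and gives a minus
  sign. As the defect is antisymmetric in the colors, only the antisymmetric half of the amplitude
  contributes, and a negative sum of squares remains.\<close>

lemma cinner_swap_defect_sum:
  fixes a b :: "'n::finite \<Rightarrow> 'm::finite"
  shows "cinner \<psi> (\<Sum>\<alpha>\<in>UNIV. \<Sum>\<beta>\<in>UNIV. create (a \<alpha>) (create (b \<beta>) (swap_defect a b \<alpha> \<beta> \<psi>)))
    = - (1 / 2) * (\<Sum>\<alpha>\<in>UNIV. \<Sum>\<beta>\<in>UNIV.
        cinner (swap_defect a b \<alpha> \<beta> \<psi>) (swap_defect a b \<alpha> \<beta> \<psi>))"
proof -
  define A where "A \<alpha> \<beta> = annih (a \<alpha>) (annih (b \<beta>) \<psi>)" for \<alpha> \<beta>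
  define D where "D \<alpha> \<beta> = swap_defect a b \<alpha> \<beta> \<psi>" for \<alpha> \<beta>
  have D: "D \<alpha> \<beta> = A \<alpha> \<beta> - A \<beta> \<alpha>" for \<alpha> \<beta>
    by (simp add: D_def A_def swap_defect_def)
  have neg: "D \<beta> \<alpha> = - D \<alpha> \<beta>" for \<alpha> \<beta>
    by (simp add: D)
  let ?S = "\<Sum>\<alpha>\<in>UNIV. \<Sum>\<beta>\<in>UNIV. cinner (A \<alpha> \<beta>) (D \<alpha> \<beta>)"
  have "cinner \<psi> (\<Sum>\<alpha>\<in>UNIV. \<Sum>\<beta>\<in>UNIV. create (a \<alpha>) (create (b \<beta>) (D \<alpha> \<beta>)))
      = (\<Sum>\<alpha>\<in>UNIV. \<Sum>\<beta>\<in>UNIV. cinner (annih (b \<beta>) (annih (a \<alpha>) \<psi>)) (D \<alpha> \<beta>))"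
    by (simp add: cinner_sum_right cinner_annih)
  also have "\<dots> = - ?S"
    by (simp add: annih_swap[of "b _"] cinner_minus_left A_def sum_negf)
  finally have lhs: "cinner \<psi> (\<Sum>\<alpha>\<in>UNIV. \<Sum>\<beta>\<in>UNIV. create (a \<alpha>) (create (b \<beta>) (D \<alpha> \<beta>))) = - ?S" .
  have "(\<Sum>\<alpha>\<in>UNIV. \<Sum>\<beta>\<in>UNIV. cinner (A \<beta> \<alpha>) (D \<alpha> \<beta>)) = (\<Sum>\<beta>\<in>UNIV. \<Sum>\<alpha>\<in>UNIV. cinner (A \<beta> \<alpha>) (D \<alpha> \<beta>))"
    by (rule sum.swap)
  also have "\<dots> = - ?S"
    by (subst neg) (simp add: cinner_minus_right sum_negf)
  finally have "(\<Sum>\<alpha>\<in>UNIV. \<Sum>\<beta>\<in>UNIV. cinner (D \<alpha> \<beta>) (D \<alpha> \<beta>)) = 2 * ?S"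
    by (subst (1) D) (simp add: cinner_diff_left sum_subtractf)
  then show ?thesis
    using lhs by (simp add: D_def)
qed

section \<open>Matrices\<close>

lemma hermitian_cinner: "hermitian A \<Longrightarrow> cinner u (A *v w) = cinner (A *v u) w"
proof -
  assume "hermitian A"
  then have A: "A $ i $ j = cnj (A $ j $ i)" for i j
    unfolding hermitian_def by blast
  have "cinner u (A *v w) = (\<Sum>i\<in>UNIV. \<Sum>j\<in>UNIV. cnj (u $ i) * (A $ i $ j * w $ j))"
    by (simp add: cinner_def matrix_vector_mult_def sum_distrib_left)
  also have "\<dots> = (\<Sum>j\<in>UNIV. \<Sum>i\<in>UNIV. cnj (u $ i) * (A $ i $ j * w $ j))"
    by (rule sum.swap)
  also have "\<dots> = (\<Sum>j\<in>UNIV. \<Sum>i\<in>UNIV. cnj (A $ j $ i * u $ i) * w $ j)"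
  proof (intro sum.cong refl)
    fix j i show "cnj (u $ i) * (A $ i $ j * w $ j) = cnj (A $ j $ i * u $ i) * w $ j"
      by (subst A) simp
  qed
  also have "\<dots> = cinner (A *v u) w"
    by (simp add: cinner_def matrix_vector_mult_def sum_distrib_right)
  finally show ?thesis .
qed

text \<open>Moving from \<open>v\<close> in the direction \<open>- (T *v v)\<close> would lower the
  quadratic form to first order and make it negative.\<close>

lemma pos_semidef_ker:
  fixes T :: "complex^'k^'k"
  assumes T: "pos_semidef T" and v: "Re (cinner v (T *v v)) = 0"
  shows "T *v v = 0"
proof (rule ccontr)
  define w where "w = T *v v"
  define c d where "c = Re (cinner w w)" and "d = Re (cinner w (T *v w))"
  assume "T *v v \<noteq> 0"
  then have c: "c > 0"
    using cinner_self_nonneg[of w] cinner_self_eq_0[of w] by (auto simp: c_def w_def less_le)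
  have herm: "hermitian T"
    using T by (simp add: pos_semidef_def)
  have "0 \<le> s * s * d - 2 * s * c" for s
  proof -
    let ?u = "v - complex_of_real s *s w"
    have "cinner ?u (T *v ?u) = cinner v (T *v v) - complex_of_real s * cinner v (T *v w)
        - complex_of_real s * cinner w w + complex_of_real (s * s) * cinner w (T *v w)"
      by (simp add: matrix_vector_mult_diff_distrib vector_scalar_commute cinner_diff_right
          cinner_diff_left cinner_scale_left cinner_scale_right w_def[symmetric] algebra_simps)
    moreover have "cinner v (T *v w) = cinner w w"
      by (simp add: hermitian_cinner[OF herm] w_def)
    ultimately have "Re (cinner ?u (T *v ?u)) = s * s * d - 2 * s * c"
      using v by (simp add: c_def d_def)
    moreover have "0 \<le> Re (cinner ?u (T *v ?u))"
      using T by (simp add: pos_semidef_def)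
    ultimately show ?thesis by simp
  qed
  \<comment> \<open>This step length \<open>s\<close> gives \<open>s * d \<le> c\<close>, so the
    linear term \<open>- 2 * s * c\<close> dominates.\<close>
  from this[of "c / (\<bar>d\<bar> + 1)"] have "0 \<le> (c / (\<bar>d\<bar> + 1)) * (c / (\<bar>d\<bar> + 1) * d - 2 * c)"
    by (simp add: algebra_simps)
  moreover have "0 < c / (\<bar>d\<bar> + 1)"
    using c by simp
  ultimately have "0 \<le> c / (\<bar>d\<bar> + 1) * d - 2 * c"
    using zero_le_mult_iff[of "c / (\<bar>d\<bar> + 1)"] by force
  then have "2 * c \<le> c * (d / (\<bar>d\<bar> + 1))"
    by simp
  also have "\<dots> \<le> c * 1"
    using c by (intro mult_left_mono) auto
  finally show False
    using c by simp
qed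

lemma orth_projection_mem: "orth_projection_onto P V \<Longrightarrow> v \<in> V \<longleftrightarrow> P *v v = v"
  by (auto simp: orth_projection_onto_def matrix_vector_mul_assoc) (metis rangeI)

lemma orth_projection_subspace: "orth_projection_onto P V \<Longrightarrow> vec.subspace V"
  by (auto simp: vec.subspace_def orth_projection_mem matrix_vector_right_distrib
      vector_scalar_commute)

lemma orth_projection_column:
  assumes "orth_projection_onto P V"
  shows "column x P \<in> V"
proof -
  have "P *v column x P = column x (P ** P)"
    by (simp add: vec_eq_iff column_def matrix_vector_mult_def matrix_matrix_mult_def)
  with assms show ?thesis
    by (simp add: orth_projection_mem orth_projection_onto_def)
qed

text \<open>The vectors \<open>\<mu> z\<close> are dual to the evaluations at the sites \<open>z \<in> I\<close>. They come from expanding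
  all columns of the projection in a maximal independent set of columns.\<close>

lemma orth_projection_local_basis:
  fixes P :: "complex^'v::finite^'v"
  assumes "orth_projection_onto P V"
  obtains I \<mu> where
    "card I = vec.dim V"
    "\<And>z. z \<in> I \<Longrightarrow> \<mu> z \<in> V"
    "\<And>z w. z \<in> I \<Longrightarrow> w \<in> I \<Longrightarrow> \<mu> z $ w = (if z = w then 1 else 0)"
    "\<And>v. v \<in> V \<Longrightarrow> v = (\<Sum>z\<in>I. v $ z *s \<mu> z)"
proof -
  have herm: "P $ x $ y = cnj (P $ y $ x)" for x y
    using assms unfolding orth_projection_onto_def hermitian_def by blast
  note Pv = orth_projection_mem[OF assms, THEN iffD1]
  note subV = orth_projection_subspace[OF assms]
  define C where "C = range (\<lambda>x. column x P)"
  have spanC: "vec.span C = V"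
  proof
    show "vec.span C \<subseteq> V"
      using orth_projection_column[OF assms] subV by (intro vec.span_minimal) (auto simp: C_def)
    show "V \<subseteq> vec.span C"
    proof
      fix v assume "v \<in> V"
      then have "v = (\<Sum>x\<in>UNIV. v $ x *s column x P)"
        using Pv[of v] matrix_mult_sum[of P v] by simp
      moreover have "(\<Sum>x\<in>UNIV. v $ x *s column x P) \<in> vec.span C"
        unfolding C_def by (intro vec.span_sum vec.span_scale vec.span_base rangeI)
      ultimately show "v \<in> vec.span C"
        by simp
    qed
  qed
  obtain B where B: "B \<subseteq> C" "vec.independent B" "C \<subseteq> vec.span B" "card B = vec.dim C"
    using vec.basis_exists by metis
  have finB: "finite B"
    by (rule finite_subset[OF B(1)]) (simp add: C_def)
  have "\<forall>b\<in>B. \<exists>x. column x P = b"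
    using B(1) unfolding C_def by blast
  then obtain g where g: "\<And>b. b \<in> B \<Longrightarrow> column (g b) P = b"
    by (auto simp: bchoice_iff)
  have inj: "inj_on g B"
    using g by (rule inj_on_inverseI)
  define I where "I = g ` B"
  have cI: "card I = vec.dim V"
    using B(4) card_image[OF inj] vec.dim_span[of C] by (simp add: I_def spanC)
  have colI: "column z P \<in> B" "g (column z P) = z" if "z \<in> I" for z
    using that g by (auto simp: I_def)
  define l where "l x z = vec.representation B (column x P) (column z P)" for x z
  \<comment> \<open>The conjugate appears because \<open>v $ x\<close> is the inner product of
    column \<open>x\<close> with \<open>v\<close>, and \<open>cinner\<close> is conjugate-linear in
    its first argument.\<close>
  define \<mu> where "\<mu> z = (\<chi> x. cnj (l x z))" for z
  have col: "column x P = (\<Sum>z\<in>I. l x z *s column z P)" for x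
  proof -
    have "column x P \<in> vec.span B"
      using B(3) by (auto simp: C_def)
    then have "column x P = (\<Sum>b\<in>B. vec.representation B (column x P) b *s b)"
      using vec.sum_representation_eq[OF B(2) _ finB order_refl] by simp
    also have "\<dots> = (\<Sum>z\<in>I. l x z *s column z P)"
      unfolding I_def sum.reindex[OF inj] by (intro sum.cong) (auto simp: g l_def)
    finally show ?thesis .
  qed
  have dual: "\<mu> z $ w = (if z = w then 1 else 0)" if "z \<in> I" "w \<in> I" for z w
  proof -
    have "column z P = column w P \<longleftrightarrow> z = w"
      using colI that by metis
    then show ?thesis
      using colI that B(2) by (simp add: \<mu>_def l_def vec.representation_basis)
  qed
  have expand: "v = (\<Sum>z\<in>I. v $ z *s \<mu> z)" if "v \<in> V" for v
  proof -
    have "v $ x = (\<Sum>z\<in>I. v $ z * \<mu> z $ x)" for x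
    proof -
      have ev: "v $ x = cinner (column x P) v" for x
      proof -
        have "v $ x = (P *v v) $ x"
          by (simp add: Pv that)
        also have "\<dots> = cinner (column x P) v"
          unfolding cinner_def column_def matrix_vector_mult_def
          by (simp flip: herm)
        finally show ?thesis .
      qed
      show ?thesis
        using ev[of x, unfolded col[of x]]
        by (simp add: cinner_sum_left cinner_scale_left \<mu>_def mult.commute flip: ev)
    qed
    then show ?thesis
      unfolding vec_eq_iff sum_component vector_smult_component by blast
  qed
  have muV: "\<mu> z \<in> V" if "z \<in> I" for z
  proof -
    \<comment> \<open>Membership comes from dimension: the vectors \<open>\<mu> z\<close> span a
      space containing \<open>V\<close>, and there are at most \<open>vec.dim V\<close> of them, so
      that span is \<open>V\<close>.\<close>
    have "V \<subseteq> vec.span (\<mu> ` I)"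
    proof
      fix v assume "v \<in> V"
      have "(\<Sum>z\<in>I. v $ z *s \<mu> z) \<in> vec.span (\<mu> ` I)"
        by (intro vec.span_sum vec.span_scale vec.span_base imageI)
      then show "v \<in> vec.span (\<mu> ` I)"
        using expand[OF \<open>v \<in> V\<close>] by simp
    qed
    moreover have "vec.dim (vec.span (\<mu> ` I)) \<le> vec.dim V"
    proof -
      have "vec.dim (vec.span (\<mu> ` I)) \<le> card (\<mu> ` I)"
        unfolding vec.dim_span by (rule vec.dim_le_card') simp
      also have "\<dots> \<le> card I"
        by (rule card_image_le) simp
      finally show ?thesis by (simp add: cI)
    qed
    ultimately have "V = vec.span (\<mu> ` I)"
      using vec.subspace_dim_equal[OF subV vec.subspace_span] by blast
    then show ?thesis
      using that vec.span_base[of "\<mu> z" "\<mu> ` I"] by simp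
  qed
  show ?thesis
    by (rule that[OF cI muV dual expand])
qed

text \<open>If the sites \<open>I\<close> split into two classes whose basis vectors never overlap, then the two spans
  are orthogonal to each other, and the projection splits accordingly.\<close>

lemma irreducible_connected:
  fixes P :: "complex^'v::finite^'v"
  assumes P: "orth_projection_onto P V"
    and irr: "irreducible_on P UNIV" and diag: "diag_support P = UNIV"
    and mem: "\<And>z. z \<in> I \<Longrightarrow> \<mu> z \<in> V"
    and nz: "\<And>z. z \<in> I \<Longrightarrow> \<mu> z \<noteq> 0"
    and expand: "\<And>v. v \<in> V \<Longrightarrow> v = (\<Sum>z\<in>I. v $ z *s \<mu> z)"
    and K: "K \<subseteq> I" "K \<noteq> {}"
    and closed: "\<And>z w x. z \<in> K \<Longrightarrow> w \<in> I \<Longrightarrow> \<mu> z $ x \<noteq> 0 \<Longrightarrow> \<mu> w $ x \<noteq> 0 \<Longrightarrow> w \<in> K"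
  shows "K = I"
proof (rule ccontr)
  assume "K \<noteq> I"
  define L where "L = I - K"
  have L: "L \<subseteq> I" "L \<noteq> {}" "K \<inter> L = {}" "K \<union> L = I"
    using K \<open>K \<noteq> I\<close> by (auto simp: L_def)
  define S1 S2 where "S1 = {x. \<exists>z\<in>K. \<mu> z $ x \<noteq> 0}" and "S2 = {x. \<exists>z\<in>L. \<mu> z $ x \<noteq> 0}"
  have herm: "P $ x $ y = cnj (P $ y $ x)" for x y
    using P unfolding orth_projection_onto_def hermitian_def by blast
  note Pv = orth_projection_mem[OF P, THEN iffD1]
  note subV = orth_projection_subspace[OF P]
  note colV = orth_projection_column[OF P]
  have disj: "S1 \<inter> S2 = {}"
    using closed[of _ _ _] L(1,3) unfolding S1_def S2_def by blast
  have "\<exists>x. \<mu> z $ x \<noteq> 0" if "z \<in> I" for z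
    using nz[OF that] by (simp add: vec_eq_iff)
  then have ne: "S1 \<noteq> {}" "S2 \<noteq> {}"
    using K L(1,2) unfolding S1_def S2_def by blast+
  have cover: "UNIV = S1 \<union> S2"
  proof -
    have "x \<in> S1 \<union> S2" for x
    proof (rule ccontr)
      assume "x \<notin> S1 \<union> S2"
      then have "\<mu> z $ x = 0" if "z \<in> I" for z
        using that L by (auto simp: S1_def S2_def)
      then have "(\<Sum>z\<in>I. column x P $ z *s \<mu> z) $ x = 0"
        by simp
      then have "column x P $ x = 0"
        by (metis expand colV)
      then show False
        using diag by (auto simp: diag_support_def column_def)
    qed
    then show ?thesis by blast
  qed
  have "P $ x $ y = 0" if x: "x \<in> S1" and y: "y \<in> S2" for x y
  proof -
    \<comment> \<open>Column \<open>y\<close> is split along \<open>K\<close> and \<open>L\<close>.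
      The part \<open>v1\<close> lies in \<open>V\<close> and vanishes at \<open>y\<close>; its
      squared norm is the conjugate of \<open>(P *v v1) $ y\<close>, which is \<open>v1 $ y\<close>,
      so \<open>v1\<close> is zero.\<close>
    define v where "v = column y P"
    define v1 where "v1 = (\<Sum>z\<in>K. v $ z *s \<mu> z)"
    define v2 where "v2 = (\<Sum>z\<in>L. v $ z *s \<mu> z)"
    have v: "v = v1 + v2"
    proof -
      have "v = (\<Sum>z\<in>K \<union> L. v $ z *s \<mu> z)"
        unfolding L(4) by (rule expand) (simp add: v_def colV)
      also have "\<dots> = v1 + v2"
        unfolding v1_def v2_def using L(3) by (intro sum.union_disjoint) auto
      finally show ?thesis .
    qed
    have v1: "v1 $ x = 0" if "x \<notin> S1" for x
      using that by (auto simp: v1_def S1_def intro!: sum.neutral)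
    have v2: "v2 $ x = 0" if "x \<notin> S2" for x
      using that by (auto simp: v2_def S2_def intro!: sum.neutral)
    have "v1 \<in> V"
      unfolding v1_def using K mem subV
      by (intro vec.subspace_sum vec.subspace_scale) auto
    have "cinner v1 v2 = 0"
      unfolding cinner_def
    proof (intro sum.neutral ballI)
      fix x show "cnj (v1 $ x) * v2 $ x = 0"
        using v1[of x] v2[of x] disj by (cases "x \<in> S1") auto
    qed
    then have "cinner v1 v1 = cinner v1 v"
      by (simp add: v cinner_add_right)
    also have "\<dots> = cnj ((P *v v1) $ y)"
    proof -
      have "cinner v1 v = (\<Sum>x\<in>UNIV. cnj (v1 $ x) * P $ x $ y)"
        by (simp add: cinner_def v_def column_def)
      also have "\<dots> = (\<Sum>x\<in>UNIV. cnj (P $ y $ x * v1 $ x))"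
        by (intro sum.cong refl, subst herm) simp
      finally show ?thesis
        by (simp add: matrix_vector_mult_def)
    qed
    also have "\<dots> = 0"
      using v1 y disj by (auto simp: Pv[OF \<open>v1 \<in> V\<close>])
    finally have "v1 = 0"
      using cinner_self_eq_0[of v1] by simp
    moreover have "v2 $ x = 0"
      using v2 x disj by auto
    ultimately have "v $ x = 0"
      by (simp add: v)
    then show ?thesis
      by (simp add: v_def column_def)
  qed
  then have "reducible_on P UNIV"
    unfolding reducible_on_def using disj ne cover by (intro exI[of _ S1] exI[of _ S2]) simp
  then show False
    using irr by (simp add: irreducible_on_def)
qed

section \<open>States with at most one fermion per basis vector\<close>

text \<open>\<open>c x \<gamma>\<close> is the mode at the site \<open>x\<close> with the color \<open>\<gamma>\<close>. The first condition says that all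
  fermions of type \<open>c\<close> occupy orbitals in the span of \<open>\<mu>\<close>.\<close>

definition hardcore ::
    "('v::finite \<Rightarrow> 'n \<Rightarrow> 'm::finite) \<Rightarrow> 'v set \<Rightarrow> ('v \<Rightarrow> complex^'v) \<Rightarrow> 'm fock \<Rightarrow> bool" where
  "hardcore c I \<mu> \<phi> \<longleftrightarrow>
     (\<forall>x \<gamma>. annih (c x \<gamma>) \<phi> = (\<Sum>z\<in>I. \<mu> z $ x *s annih (c z \<gamma>) \<phi>)) \<and>
     (\<forall>z\<in>I. \<forall>\<alpha> \<beta>. annih (c z \<alpha>) (annih (c z \<beta>) \<phi>) = 0)"

definition modes :: "('v \<Rightarrow> 'n \<Rightarrow> 'm) \<Rightarrow> 'm set" where
  "modes c = (\<Union>x. range (c x))"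

lemma mode_in_modes [simp]: "c x \<gamma> \<in> modes c"
  by (auto simp: modes_def)

lemma hardcoreD:
  assumes "hardcore c I \<mu> \<phi>"
  shows "annih (c x \<gamma>) \<phi> = (\<Sum>z\<in>I. \<mu> z $ x *s annih (c z \<gamma>) \<phi>)"
    and "z \<in> I \<Longrightarrow> annih (c z \<alpha>) (annih (c z \<beta>) \<phi>) = 0"
  using assms unfolding hardcore_def by blast+

text \<open>Anticommuting past one operator flips the sign on both sides, past two it flips nothing.
  As \<open>m\<close> is arbitrary, fermions can be removed one at a time without leaving the
  class.\<close>

lemma hardcore_annih:
  assumes "hardcore c I \<mu> \<phi>"
  shows "hardcore c I \<mu> (annih m \<phi>)"
  unfolding hardcore_def
proof (intro conjI allI ballI)
  fix x \<gamma>
  have "annih (c x \<gamma>) (annih m \<phi>) = - annih m (\<Sum>z\<in>I. \<mu> z $ x *s annih (c z \<gamma>) \<phi>)"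
    using annih_swap[of "c x \<gamma>" m] hardcoreD(1)[OF assms, of x \<gamma>] by simp
  also have "\<dots> = (\<Sum>z\<in>I. \<mu> z $ x *s annih (c z \<gamma>) (annih m \<phi>))"
    by (simp add: annih_sum annih_scale annih_swap[of m] sum_negf)
  finally show "annih (c x \<gamma>) (annih m \<phi>) = (\<Sum>z\<in>I. \<mu> z $ x *s annih (c z \<gamma>) (annih m \<phi>))" .
next
  fix z \<alpha> \<beta> assume "z \<in> I"
  then show "annih (c z \<alpha>) (annih (c z \<beta>) (annih m \<phi>)) = 0"
    by (simp add: hardcoreD(2)[OF assms] flip: annih_pair_swap[of m])
qed

lemma hardcore_diff:
  assumes "hardcore c I \<mu> \<psi>" "hardcore c I \<mu> \<phi>"
  shows "hardcore c I \<mu> (\<psi> - \<phi>)"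
  unfolding hardcore_def
proof (intro conjI allI ballI)
  fix x \<gamma>
  show "annih (c x \<gamma>) (\<psi> - \<phi>) = (\<Sum>z\<in>I. \<mu> z $ x *s annih (c z \<gamma>) (\<psi> - \<phi>))"
    using hardcoreD(1)[OF assms(1), of x \<gamma>] hardcoreD(1)[OF assms(2), of x \<gamma>]
    by (simp only: annih_diff vec.scale_right_diff_distrib sum_subtractf)
qed (simp add: annih_diff hardcoreD(2)[OF assms(1)] hardcoreD(2)[OF assms(2)])

lemma hardcore_scale:
  assumes "hardcore c I \<mu> \<phi>"
  shows "hardcore c I \<mu> (a *s \<phi>)"
  unfolding hardcore_def
proof (intro conjI allI ballI)
  fix x \<gamma>
  show "annih (c x \<gamma>) (a *s \<phi>) = (\<Sum>z\<in>I. \<mu> z $ x *s annih (c z \<gamma>) (a *s \<phi>))"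
    unfolding annih_scale by (subst hardcoreD(1)[OF assms]) (simp add: scale_sum mult.commute)
qed (simp add: annih_scale hardcoreD(2)[OF assms])

lemma hardcore_sum:
  assumes "\<And>p. p \<in> X \<Longrightarrow> hardcore c I \<mu> (\<phi> p)"
  shows "hardcore c I \<mu> (\<Sum>p\<in>X. \<phi> p)"
  unfolding hardcore_def
proof (intro conjI allI ballI)
  fix x \<gamma>
  have "annih (c x \<gamma>) (\<Sum>p\<in>X. \<phi> p) = (\<Sum>p\<in>X. \<Sum>z\<in>I. \<mu> z $ x *s annih (c z \<gamma>) (\<phi> p))"
    unfolding annih_sum by (intro sum.cong refl hardcoreD(1) assms)
  also have "\<dots> = (\<Sum>z\<in>I. \<mu> z $ x *s annih (c z \<gamma>) (\<Sum>p\<in>X. \<phi> p))"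
    unfolding annih_sum scale_sum by (rule sum.swap)
  finally show "annih (c x \<gamma>) (\<Sum>p\<in>X. \<phi> p) = (\<Sum>z\<in>I. \<mu> z $ x *s annih (c z \<gamma>) (\<Sum>p\<in>X. \<phi> p))" .
qed (simp add: annih_sum hardcoreD(2)[OF assms])

text \<open>Truncated subtraction is harmless: for \<open>k = 0\<close> every mode of
  \<open>M\<close> is empty and both sides vanish.\<close>

lemma num_op_annih_mode:
  assumes "num_op M \<phi> = of_nat k *s \<phi>" "m \<in> M"
  shows "num_op M (annih m \<phi>) = of_nat (k - 1) *s annih m \<phi>"
proof (cases k)
  case 0
  with assms have "annih m \<phi> = 0"
    by (intro num_op_eq_0D) auto
  then show ?thesis
    by (simp add: num_op_def)
next
  case (Suc n)
  with assms show ?thesis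
    by (simp add: num_op_annih annih_scale annih_add vec.scale_left_distrib)
qed

text \<open>A pigeonhole principle: with at most one fermion on each basis vector, \<open>k\<close>
  fermions do not fit on fewer than \<open>k\<close> of them. Removing one at a site
  \<open>z\<close> of \<open>A\<close> also closes \<open>z\<close>, which drives the
  induction.\<close>

lemma hardcore_vanish:
  assumes "hardcore c I \<mu> \<phi>" "num_op (modes c) \<phi> = of_nat k *s \<phi>"
    and "finite A" "card A < k" "\<And>z \<gamma>. z \<in> I \<Longrightarrow> z \<notin> A \<Longrightarrow> annih (c z \<gamma>) \<phi> = 0"
  shows "\<phi> = 0"
  using assms
proof (induction k arbitrary: A \<phi>)
  case (Suc k)
  have kill: "annih (c z \<gamma>) \<phi> = 0" if "z \<in> I" for z \<gamma>
  proof (cases "z \<in> A")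
    case True
    show ?thesis
    proof (rule Suc.IH)
      show "hardcore c I \<mu> (annih (c z \<gamma>) \<phi>)"
        by (rule hardcore_annih) (rule Suc.prems)
      show "num_op (modes c) (annih (c z \<gamma>) \<phi>) = of_nat k *s annih (c z \<gamma>) \<phi>"
        using num_op_annih_mode[OF Suc.prems(2), of "c z \<gamma>"] by simp
      show "finite (A - {z})"
        using Suc.prems(3) by simp
      show "card (A - {z}) < k"
        using card_Diff1_less[OF Suc.prems(3) True] Suc.prems(4) by linarith
      fix w \<delta> assume "w \<in> I" "w \<notin> A - {z}"
      then show "annih (c w \<delta>) (annih (c z \<gamma>) \<phi>) = 0"
        using hardcoreD(2)[OF Suc.prems(1)] Suc.prems(5) annih_swap[of "c w \<delta>"] by (cases "w = z") auto
    qed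
  qed (use that Suc.prems(5) in auto)
  have "annih (c x \<gamma>) \<phi> = 0" for x \<gamma>
    using hardcoreD(1)[OF Suc.prems(1)] kill by simp
  then have "num_op (modes c) \<phi> = 0"
    by (auto simp: num_op_def modes_def intro!: sum.neutral)
  then show ?case
    using Suc.prems(2) by (simp del: of_nat_Suc)
qed simp

text \<open>Each term has one fermion on every basis vector of \<open>I - K p\<close> and none on
  \<open>K p\<close>. Different hole sets are different occupation patterns, so a vanishing sum
  vanishes pattern by pattern. Removing a fermion at \<open>z\<close> adds \<open>z\<close> to the
  hole sets and discards the terms where it was a hole already.\<close>

lemma hardcore_independent:
  fixes \<phi> :: "'p \<Rightarrow> 'm::finite fock" and c :: "'v::finite \<Rightarrow> 'n \<Rightarrow> 'm"
  assumes "finite X" "\<And>p. p \<in> X \<Longrightarrow> hardcore c I \<mu> (\<phi> p)"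
    and "\<And>p. p \<in> X \<Longrightarrow> num_op (modes c) (\<phi> p) = of_nat k *s \<phi> p"
    and "\<And>p. p \<in> X \<Longrightarrow> K p \<subseteq> I" "\<And>p. p \<in> X \<Longrightarrow> card (I - K p) = k"
    and "\<And>p z \<gamma>. p \<in> X \<Longrightarrow> z \<in> K p \<Longrightarrow> annih (c z \<gamma>) (\<phi> p) = 0"
    and "(\<Sum>p\<in>X. \<phi> p) = 0"
  shows "(\<Sum>p | p \<in> X \<and> K p = B. \<phi> p) = 0"
  using assms
proof (induction k arbitrary: \<phi> X K B)
  case 0
  then have "K p = I" if "p \<in> X" for p
    using that 0(4,5)[OF that] by (simp add: subset_antisym)
  then have "{p \<in> X. K p = B} = (if B = I then X else {})"
    by auto
  then show ?case
    using 0 by simp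
next
  case (Suc k)
  let ?Y = "{p \<in> X. K p = B}"
  let ?S = "\<Sum>p\<in>?Y. \<phi> p"
  show ?case
  proof (cases "?Y = {}")
    case False
    then have B: "card (I - B) = Suc k" "B \<subseteq> I"
      using Suc.prems(4,5) by auto
    have kill: "annih (c z \<gamma>) ?S = 0" if "z \<in> I" for z \<gamma>
    proof (cases "z \<in> B")
      case True
      then show ?thesis
        using Suc.prems(6) by (auto simp: annih_sum intro!: sum.neutral)
    next
      case z: False
      let ?X = "{p \<in> X. z \<notin> K p}"
      have "(\<Sum>p | p \<in> ?X \<and> insert z (K p) = insert z B. annih (c z \<gamma>) (\<phi> p)) = 0"
      proof (rule Suc.IH)
        show "finite ?X"
          using Suc.prems(1) by simp
        have "(\<Sum>p\<in>?X. annih (c z \<gamma>) (\<phi> p)) = (\<Sum>p\<in>X. annih (c z \<gamma>) (\<phi> p))"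
          using Suc.prems(1,6) by (intro sum.mono_neutral_left) auto
        also have "\<dots> = annih (c z \<gamma>) (\<Sum>p\<in>X. \<phi> p)"
          by (simp add: annih_sum)
        also have "\<dots> = 0"
          by (simp add: Suc.prems(7))
        finally show "(\<Sum>p\<in>?X. annih (c z \<gamma>) (\<phi> p)) = 0" .
        fix p assume p: "p \<in> ?X"
        then show "hardcore c I \<mu> (annih (c z \<gamma>) (\<phi> p))"
          using Suc.prems(2) by (intro hardcore_annih) auto
        show "num_op (modes c) (annih (c z \<gamma>) (\<phi> p)) = of_nat k *s annih (c z \<gamma>) (\<phi> p)"
          using num_op_annih_mode[OF Suc.prems(3), of p "c z \<gamma>"] p by simp
        show "insert z (K p) \<subseteq> I"
          using Suc.prems(4) p that by auto
        have "I - insert z (K p) = (I - K p) - {z}"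
          by auto
        then show "card (I - insert z (K p)) = k"
          using Suc.prems(5) p that by (simp add: card_Diff_singleton)
        fix w \<delta> assume "w \<in> insert z (K p)"
        then show "annih (c w \<delta>) (annih (c z \<gamma>) (\<phi> p)) = 0"
          using Suc.prems(6)[of p w \<delta>] p hardcoreD(2)[OF Suc.prems(2), of p z] that
            annih_swap[of "c w \<delta>" "c z \<gamma>"] by auto
      qed
      \<comment> \<open>As \<open>z\<close> is in none of the original hole sets, inserting it
        merges no groups.\<close>
      moreover have "{p. p \<in> ?X \<and> insert z (K p) = insert z B} = ?Y"
        using z by (auto simp: insert_ident)
      ultimately show ?thesis
        by (simp add: annih_sum)
    qed
    show ?thesis
    proof (rule hardcore_vanish)
      show "hardcore c I \<mu> ?S"
        using Suc.prems(2) by (intro hardcore_sum) auto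
      show "num_op (modes c) ?S = of_nat (Suc k) *s ?S"
        using Suc.prems(3) by (simp add: num_op_sum scale_sum del: of_nat_Suc)
      show "finite ({} :: 'v set)" "card ({} :: 'v set) < Suc k"
        by simp_all
    qed (use kill in auto)
  next
    case True
    then show ?thesis
      by (simp only: sum.empty)
  qed
qed

section \<open>Color symmetry from irreducibility\<close>

text \<open>At each site the local conditions permute three colors: \<open>c c f\<close> is antisymmetric in the first
  two and symmetric in the last two, and hence zero.\<close>

lemma hardcore_of_swap_sym:
  fixes c f :: "'n::finite \<Rightarrow> 'm::finite"
  assumes sym: "swap_sym c f \<psi>" and one: "num_op (range f) \<psi> = \<psi>" and disj: "range c \<inter> range f = {}"
  shows "annih (c \<alpha>) (annih (c \<gamma>) \<psi>) = 0"
proof -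
  define X where "X \<alpha> \<gamma> \<beta> = annih (c \<alpha>) (annih (c \<gamma>) (annih (f \<beta>) \<psi>))" for \<alpha> \<gamma> \<beta>
  have s12: "X \<alpha> \<gamma> \<beta> = - X \<gamma> \<alpha> \<beta>" for \<alpha> \<gamma> \<beta>
    unfolding X_def by (rule annih_swap)
  have s23: "X \<alpha> \<gamma> \<beta> = X \<alpha> \<beta> \<gamma>" for \<alpha> \<gamma> \<beta>
    unfolding X_def by (simp only: swap_symD[OF sym, of \<gamma> \<beta>])
  \<comment> \<open>Alternating the two exchanges, three of each, brings all colors back to their
    places and collects three minus signs.\<close>
  have "X \<alpha> \<gamma> \<beta> = - X \<alpha> \<gamma> \<beta>" for \<alpha> \<gamma> \<beta>
    by (metis s12 s23 add.inverse_inverse)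
  then have X0: "X \<alpha> \<gamma> \<beta> = 0" for \<alpha> \<gamma> \<beta>
    by (metis eq_neg_iff_add_eq_0 vec.scale_eq_0_iff vec.scale_left_distrib vec.scale_one
        one_add_one zero_neq_numeral)
  let ?\<phi> = "annih (c \<alpha>) (annih (c \<gamma>) \<psi>)"
  have notin: "c \<alpha> \<notin> range f" "c \<gamma> \<notin> range f"
    using disj by auto
  \<comment> \<open>Removing itinerant fermions leaves the single localized one in place, yet by
    \<open>X0\<close> no localized fermion can be removed.\<close>
  have "annih (f \<beta>) ?\<phi> = 0" for \<beta>
    using X0[of \<alpha> \<gamma> \<beta>] annih_pair_swap[of "f \<beta>" "c \<alpha>" "c \<gamma>" \<psi>] by (simp add: X_def)
  then have "num_op (range f) ?\<phi> = 0"
    by (auto simp: num_op_def intro!: sum.neutral)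
  moreover have "num_op (range f) ?\<phi> = ?\<phi>"
    using notin by (simp add: num_op_annih one)
  ultimately show ?thesis
    by simp
qed

text \<open>What the energy argument provides, for abstract modes. Irreducibility enters as
  \<open>connected\<close>: a nonempty subset of \<open>I\<close> closed under overlap of the
  vectors \<open>\<mu> z\<close> is all of \<open>I\<close>. The exclusion \<open>cc0\<close> is
  stated at every site, because it is expanded at sites where two vectors overlap.\<close>

locale local_swap_state =
  fixes c f :: "'v::finite \<Rightarrow> 'n::finite \<Rightarrow> 'm::finite" and I \<mu> \<psi>
  assumes disj: "modes c \<inter> modes f = {}"
    and hc: "hardcore c I \<mu> \<psi>"
    and cc0: "annih (c x \<alpha>) (annih (c x \<beta>) \<psi>) = 0"
    and num: "num_op (modes c) \<psi> = of_nat (card I) *s \<psi>"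
    and cf_local: "swap_sym (c x) (f x) \<psi>"
    and I: "I \<noteq> {}"
    and cover: "\<exists>z\<in>I. \<mu> z $ x \<noteq> 0"
    and connected: "\<lbrakk>K \<subseteq> I; K \<noteq> {};
      \<And>z w x. z \<in> K \<Longrightarrow> w \<in> I \<Longrightarrow> \<mu> z $ x \<noteq> 0 \<Longrightarrow> \<mu> w $ x \<noteq> 0 \<Longrightarrow> w \<in> K\<rbrakk> \<Longrightarrow> K = I"
begin

lemma c_expand: "annih (c x \<gamma>) (annih m \<psi>) = (\<Sum>z\<in>I. \<mu> z $ x *s annih (c z \<gamma>) (annih m \<psi>))"
  by (rule hardcoreD(1)[OF hardcore_annih[OF hc]])

lemma hc_defect: "hardcore c I \<mu> (swap_defect a b \<alpha> \<beta> \<psi>)"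
  unfolding swap_defect_def by (intro hardcore_diff hardcore_annih hc)

lemma num_cc: "num_op (modes c) (annih (c x \<alpha>) (annih (c y \<beta>) \<psi>))
    = of_nat (card I - 2) *s annih (c x \<alpha>) (annih (c y \<beta>) \<psi>)"
  using num_op_annih_mode[OF num_op_annih_mode[OF num]] by (simp add: numeral_2_eq_2)

lemma num_op_f: "num_op (modes c) (annih (f y \<beta>) \<phi>) = annih (f y \<beta>) (num_op (modes c) \<phi>)"
  using disj mode_in_modes[of f y \<beta>] by (auto simp: num_op_annih)

lemma num_cf: "num_op (modes c) (annih (c x \<alpha>) (annih (f y \<beta>) \<psi>))
    = of_nat (card I - 1) *s annih (c x \<alpha>) (annih (f y \<beta>) \<psi>)"
  by (rule num_op_annih_mode) (simp_all add: num_op_f num annih_scale)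

lemma num_ff: "num_op (modes c) (annih (f x \<alpha>) (annih (f y \<beta>) \<psi>))
    = of_nat (card I) *s annih (f x \<alpha>) (annih (f y \<beta>) \<psi>)"
  by (simp add: num_op_f num annih_scale)

section \<open>Exchange of two itinerant fermions\<close>

lemma cc_same: "swap_sym (c x) (c x) \<psi>"
  by (simp add: swap_sym_def swap_defect_def cc0)

lemma annih_c_twice: "annih (c x \<alpha>) (annih (c x \<beta>) (annih m \<psi>)) = 0"
  by (simp add: cc0 flip: annih_pair_swap[of m])

lemma annih_c_around: "annih (c x \<alpha>) (annih m (annih (c x \<beta>) \<psi>)) = 0"
  by (simp add: annih_pair_swap[of "c x \<alpha>"] cc0)

lemma annih_c_defect_cc: "annih (c z \<gamma>) (swap_defect (c z) (c w) \<alpha> \<beta> \<psi>) = 0"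
  by (simp add: swap_defect_def annih_diff annih_c_twice)

text \<open>Expanding \<open>cc0\<close> at \<open>x\<close> gives a vanishing sum over pairs of
  basis vectors. Independence isolates the unordered pair \<open>{z, w}\<close>, whose two orderings
  combine into the defect with the nonzero factor \<open>\<mu> z $ x * \<mu> w $ x\<close>.\<close>

lemma cc_edge:
  assumes z: "z \<in> I" "\<mu> z $ x \<noteq> 0" and w: "w \<in> I" "\<mu> w $ x \<noteq> 0"
  shows "swap_sym (c z) (c w) \<psi>"
proof (cases "z = w")
  case False
  have "swap_defect (c z) (c w) \<alpha> \<beta> \<psi> = 0" for \<alpha> \<beta>
  proof -
    define X where "X = {p \<in> I \<times> I. fst p \<noteq> snd p}"
    define \<phi> where "\<phi> p = (\<mu> (fst p) $ x * \<mu> (snd p) $ x) *s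
      annih (c (fst p) \<alpha>) (annih (c (snd p) \<beta>) \<psi>)" for p
    have "(\<Sum>p | p \<in> X \<and> {fst p, snd p} = {z, w}. \<phi> p) = 0"
    proof (rule hardcore_independent)
      show "finite X"
        by (simp add: X_def)
      have "0 = annih (c x \<alpha>) (annih (c x \<beta>) \<psi>)"
        by (simp add: cc0)
      also have "\<dots> = (\<Sum>u\<in>I. \<mu> u $ x *s annih (c u \<alpha>) (annih (c x \<beta>) \<psi>))"
        by (rule c_expand)
      also have "\<dots> = (\<Sum>u\<in>I. \<mu> u $ x *s annih (c u \<alpha>) (\<Sum>v\<in>I. \<mu> v $ x *s annih (c v \<beta>) \<psi>))"
        by (simp only: hardcoreD(1)[OF hc, of x \<beta>])
      also have "\<dots> = (\<Sum>p\<in>I \<times> I. \<phi> p)"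
        by (simp add: \<phi>_def annih_sum annih_scale scale_sum sum.cartesian_product case_prod_beta)
      also have "\<dots> = (\<Sum>p\<in>X. \<phi> p)"
        by (rule sum.mono_neutral_right) (auto simp: X_def \<phi>_def cc0)
      finally show "(\<Sum>p\<in>X. \<phi> p) = 0"
        by simp
      fix p assume p: "p \<in> X"
      show "hardcore c I \<mu> (\<phi> p)"
        unfolding \<phi>_def by (intro hardcore_scale hardcore_annih hc)
      show "num_op (modes c) (\<phi> p) = of_nat (card I - 2) *s \<phi> p"
        by (simp add: \<phi>_def num_op_scale num_cc mult.commute)
      show "{fst p, snd p} \<subseteq> I"
        using p by (auto simp: X_def)
      then show "card (I - {fst p, snd p}) = card I - 2"
        using p by (subst card_Diff_subset) (auto simp: X_def)
      show "annih (c v \<gamma>) (\<phi> p) = 0" if "v \<in> {fst p, snd p}" for v \<gamma>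
        using that by (auto simp: \<phi>_def annih_scale annih_c_twice annih_c_around)
    qed
    moreover have "{p. p \<in> X \<and> {fst p, snd p} = {z, w}} = {(z, w), (w, z)}"
      using z w False by (auto simp: X_def doubleton_eq_iff)
    ultimately have "(\<mu> z $ x * \<mu> w $ x) *s swap_defect (c z) (c w) \<alpha> \<beta> \<psi> = 0"
      using False
      by (simp add: \<phi>_def swap_defect_def vec.scale_right_diff_distrib annih_swap[of "c w \<alpha>"] mult.commute)
    then show ?thesis
      using z w by simp
  qed
  then show ?thesis
    by (simp add: swap_sym_def)
qed (simp add: cc_same)

text \<open>By the bridge the defect allows no removal at \<open>v\<close>, and none at
  \<open>u\<close> or \<open>w\<close>, whose fermions are already gone. Its
  \<open>card I - 2\<close> fermions would have to fit on \<open>card I - 3\<close> basis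
  vectors.\<close>

lemma cc_trans:
  assumes I: "u \<in> I" "v \<in> I" "w \<in> I"
    and uv: "swap_sym (c u) (c v) \<psi>" and vw: "swap_sym (c v) (c w) \<psi>"
  shows "swap_sym (c u) (c w) \<psi>"
proof -
  consider "u = w" | "u = v" | "v = w" | "card {u, v, w} = 3" "u \<noteq> w"
    by fastforce
  then show ?thesis
  proof cases
    case 4
    have "swap_defect (c u) (c w) \<alpha> \<beta> \<psi> = 0" for \<alpha> \<beta>
    proof (rule hardcore_vanish[OF hc_defect])
      show "num_op (modes c) (swap_defect (c u) (c w) \<alpha> \<beta> \<psi>)
          = of_nat (card I - 2) *s swap_defect (c u) (c w) \<alpha> \<beta> \<psi>"
        by (simp add: swap_defect_def num_op_diff num_cc vec.scale_right_diff_distrib)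
      \<comment> \<open>With three distinct sites in \<open>I\<close>, the truncated subtractions
        are genuine and the inequality is strict.\<close>
      have "card {u, v, w} \<le> card I"
        using I by (intro card_mono) auto
      then show "card (I - {u, v, w}) < card I - 2"
        using 4 I by (subst card_Diff_subset) auto
      fix z \<gamma> assume "z \<in> I" "z \<notin> I - {u, v, w}"
      then show "annih (c z \<gamma>) (swap_defect (c u) (c w) \<alpha> \<beta> \<psi>) = 0"
        using annih_c_defect_cc[of u \<gamma> w] annih_c_defect_cc[of w \<gamma> u \<alpha> \<beta>]
          swap_defect_bridge[OF uv vw, of \<gamma>]
        by (auto simp: swap_defect_commute[of "c w" "c u"])
    qed simp
    then show ?thesis
      by (simp add: swap_sym_def)
  qed (use assms in \<open>simp_all add: cc_same\<close>)
qed

text \<open>The partners symmetric with \<open>z\<close> are closed under overlap, by one edge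
  followed by transitivity, so connectedness gives all of \<open>I\<close>.\<close>

lemma cc_sym_I:
  assumes "z \<in> I" "w \<in> I"
  shows "swap_sym (c z) (c w) \<psi>"
proof -
  have "{w \<in> I. swap_sym (c z) (c w) \<psi>} = I"
  proof (rule connected)
    show "{w \<in> I. swap_sym (c z) (c w) \<psi>} \<noteq> {}"
      using assms(1) cc_same by auto
    fix u v x assume "u \<in> {w \<in> I. swap_sym (c z) (c w) \<psi>}" "v \<in> I" "\<mu> u $ x \<noteq> 0" "\<mu> v $ x \<noteq> 0"
    then show "v \<in> {w \<in> I. swap_sym (c z) (c w) \<psi>}"
      using cc_edge[of u x v] cc_trans[of z u v] assms(1) by auto
  qed auto
  then show ?thesis
    using assms(2) by blast
qed

text \<open>The defect is linear in the annihilator at \<open>x\<close>, so symmetry on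
  \<open>I\<close> passes to all sites.\<close>

lemma swap_sym_c_expand:
  assumes "\<And>z. z \<in> I \<Longrightarrow> swap_sym (c z) b \<psi>"
  shows "swap_sym (c x) b \<psi>"
proof -
  have "swap_defect (c x) b \<alpha> \<beta> \<psi> = (\<Sum>z\<in>I. \<mu> z $ x *s swap_defect (c z) b \<alpha> \<beta> \<psi>)" for \<alpha> \<beta>
    unfolding swap_defect_def c_expand[of x]
    by (simp add: vec.scale_right_diff_distrib sum_subtractf)
  then show ?thesis
    using assms by (simp add: swap_sym_def)
qed

lemma cc_sym: "swap_sym (c x) (c y) \<psi>"
proof (rule swap_sym_c_expand)
  fix z assume z: "z \<in> I"
  have "swap_sym (c y) (c z) \<psi>"
    by (rule swap_sym_c_expand) (simp add: cc_sym_I z)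
  then show "swap_sym (c z) (c y) \<psi>"
    by (simp add: swap_sym_commute[of "c z"])
qed

section \<open>Exchanges involving localized fermions\<close>

lemma num_defect_cf: "num_op (modes c) (swap_defect (c z) (f y) \<alpha> \<beta> \<psi>)
    = of_nat (card I - 1) *s swap_defect (c z) (f y) \<alpha> \<beta> \<psi>"
  by (simp add: swap_defect_def num_op_diff num_cf vec.scale_right_diff_distrib)

lemma annih_c_defect_cf: "annih (c z \<gamma>) (swap_defect (c z) (f y) \<alpha> \<beta> \<psi>) = 0"
  by (simp add: swap_defect_def annih_diff annih_c_twice)

text \<open>In the expansion of the local condition at \<open>y\<close>, the term of
  \<open>w\<close> has the single hole \<open>w\<close>; distinct holes make the terms vanish one by
  one.\<close>

lemma cf_edge:
  assumes z: "z \<in> I" "\<mu> z $ y \<noteq> 0"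
  shows "swap_sym (c z) (f y) \<psi>"
proof -
  have "swap_defect (c z) (f y) \<alpha> \<beta> \<psi> = 0" for \<alpha> \<beta>
  proof -
    define \<phi> where "\<phi> w = \<mu> w $ y *s swap_defect (c w) (f y) \<alpha> \<beta> \<psi>" for w
    have "(\<Sum>w | w \<in> I \<and> {w} = {z}. \<phi> w) = 0"
    proof (rule hardcore_independent)
      have "0 = swap_defect (c y) (f y) \<alpha> \<beta> \<psi>"
        using cf_local by (simp add: swap_sym_def)
      also have "\<dots> = (\<Sum>w\<in>I. \<phi> w)"
        unfolding swap_defect_def \<phi>_def c_expand[of y]
        by (simp add: vec.scale_right_diff_distrib sum_subtractf)
      finally show "(\<Sum>w\<in>I. \<phi> w) = 0"
        by simp
      fix w assume w: "w \<in> I"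
      show "hardcore c I \<mu> (\<phi> w)"
        unfolding \<phi>_def by (intro hardcore_scale hc_defect)
      show "num_op (modes c) (\<phi> w) = of_nat (card I - 1) *s \<phi> w"
        by (simp add: \<phi>_def num_op_scale num_defect_cf mult.commute)
      show "card (I - {w}) = card I - 1"
        using w by simp
      show "annih (c v \<gamma>) (\<phi> w) = 0" if "v \<in> {w}" for v \<gamma>
        using that by (simp add: \<phi>_def annih_scale annih_c_defect_cf)
    qed auto
    moreover have "{w. w \<in> I \<and> {w} = {z}} = {z}"
      using z by auto
    ultimately show ?thesis
      using z by (simp add: \<phi>_def)
  qed
  then show ?thesis
    by (simp add: swap_sym_def)
qed

text \<open>Some \<open>z\<close> in \<open>I\<close> does not vanish at \<open>y\<close>, and its
  fermion is the bridge from any other \<open>w\<close> to the localized one. The defect then allows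
  no removal at \<open>w\<close> or \<open>z\<close>, which leaves too few places for its
  \<open>card I - 1\<close> fermions.\<close>

lemma cf_sym: "swap_sym (c x) (f y) \<psi>"
proof (rule swap_sym_c_expand)
  obtain z where z: "z \<in> I" "\<mu> z $ y \<noteq> 0"
    using cover by blast
  fix w assume w: "w \<in> I"
  show "swap_sym (c w) (f y) \<psi>"
  proof (cases "w = z")
    case False
    have "swap_defect (c w) (f y) \<alpha> \<beta> \<psi> = 0" for \<alpha> \<beta>
    proof (rule hardcore_vanish[OF hc_defect num_defect_cf])
      have "card {w, z} \<le> card I"
        using w z by (intro card_mono) auto
      then show "card (I - {w, z}) < card I - 1"
        using False w z by (subst card_Diff_subset) auto
      fix v \<gamma> assume "v \<in> I" "v \<notin> I - {w, z}"
      then show "annih (c v \<gamma>) (swap_defect (c w) (f y) \<alpha> \<beta> \<psi>) = 0"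
        using annih_c_defect_cf swap_defect_bridge[OF cc_sym cf_edge[OF z]] by auto
    qed simp
    then show ?thesis
      by (simp add: swap_sym_def)
  qed (simp add: cf_edge z)
qed

text \<open>Any itinerant fermion bridges two localized ones. The defect still contains all
  \<open>card I > 0\<close> itinerant fermions but allows none to be removed.\<close>

lemma ff_sym: "swap_sym (f x) (f y) \<psi>"
proof -
  have "swap_defect (f x) (f y) \<alpha> \<beta> \<psi> = 0" for \<alpha> \<beta>
  proof (rule hardcore_vanish[OF hc_defect])
    show "num_op (modes c) (swap_defect (f x) (f y) \<alpha> \<beta> \<psi>)
        = of_nat (card I) *s swap_defect (f x) (f y) \<alpha> \<beta> \<psi>"
      by (simp add: swap_defect_def num_op_diff num_ff vec.scale_right_diff_distrib)
    show "card ({} :: 'v set) < card I"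
      using I by (simp add: card_gt_0_iff)
    show "annih (c z \<gamma>) (swap_defect (f x) (f y) \<alpha> \<beta> \<psi>) = 0" for z \<gamma>
      using cf_sym by (intro swap_defect_bridge) (simp_all add: swap_sym_commute[of "f x"])
  qed simp
  then show ?thesis
    by (simp add: swap_sym_def)
qed

end

section \<open>Kinetic energy and modes\<close>

text \<open>For each occupation set \<open>S\<close> of the remaining modes, the amplitudes over the
  position of the removed fermion form a one-particle wave function, and the hopping energy adds up
  their quadratic forms.\<close>

lemma cinner_kinetic:
  fixes T :: "complex^'v::finite^'v" and c :: "'v \<Rightarrow> 'm::finite"
  shows "cinner \<psi> (\<Sum>x\<in>UNIV. \<Sum>y\<in>UNIV. T $ x $ y *s create (c x) (annih (c y) \<psi>))
    = (\<Sum>S\<in>UNIV. cinner (\<chi> x. annih (c x) \<psi> $ S) (T *v (\<chi> x. annih (c x) \<psi> $ S)))"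
proof -
  have "cinner \<psi> (\<Sum>x\<in>UNIV. \<Sum>y\<in>UNIV. T $ x $ y *s create (c x) (annih (c y) \<psi>))
      = (\<Sum>x\<in>UNIV. \<Sum>y\<in>UNIV. \<Sum>S\<in>UNIV.
          cnj (annih (c x) \<psi> $ S) * (T $ x $ y * annih (c y) \<psi> $ S))"
    by (simp add: cinner_sum_right cinner_scale_right flip: cinner_annih)
       (simp add: cinner_def sum_distrib_left algebra_simps)
  also have "\<dots> = (\<Sum>S\<in>UNIV. \<Sum>x\<in>UNIV. \<Sum>y\<in>UNIV.
          cnj (annih (c x) \<psi> $ S) * (T $ x $ y * annih (c y) \<psi> $ S))"
    by (subst (2) sum.swap, subst sum.swap) simp
  also have "\<dots> = (\<Sum>S\<in>UNIV. cinner (\<chi> x. annih (c x) \<psi> $ S) (T *v (\<chi> x. annih (c x) \<psi> $ S)))"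
    by (simp add: cinner_def matrix_vector_mult_def sum_distrib_left)
  finally show ?thesis .
qed

lemma kinetic_nonneg:
  fixes T :: "complex^'v::finite^'v" and c :: "'v \<Rightarrow> 'm::finite"
  assumes "pos_semidef T"
  shows "0 \<le> Re (cinner \<psi> (\<Sum>x\<in>UNIV. \<Sum>y\<in>UNIV. T $ x $ y *s create (c x) (annih (c y) \<psi>)))"
  using assms by (simp add: cinner_kinetic pos_semidef_def sum_nonneg)

lemma kinetic_eq_0D:
  fixes T :: "complex^'v::finite^'v" and c :: "'v \<Rightarrow> 'm::finite"
  assumes T: "pos_semidef T"
    and 0: "Re (cinner \<psi> (\<Sum>x\<in>UNIV. \<Sum>y\<in>UNIV. T $ x $ y *s create (c x) (annih (c y) \<psi>))) = 0"
  shows "(\<chi> x. annih (c x) \<psi> $ S) \<in> mat_ker T"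
proof -
  have "(\<Sum>S\<in>UNIV. Re (cinner (\<chi> x. annih (c x) \<psi> $ S) (T *v (\<chi> x. annih (c x) \<psi> $ S)))) = 0"
    using 0 by (simp add: cinner_kinetic)
  then have "Re (cinner (\<chi> x. annih (c x) \<psi> $ S) (T *v (\<chi> x. annih (c x) \<psi> $ S))) = 0"
    using T by (subst (asm) sum_nonneg_eq_0_iff) (auto simp: pos_semidef_def)
  then show ?thesis
    using pos_semidef_ker[OF T] by (simp add: mat_ker_def)
qed

text \<open>Normal ordering of a color exchange. The conditional terms are the contractions; they
  are kept because the Casimir operator includes the case of coinciding \<open>a\<close> and
  \<open>b\<close>.\<close>

lemma exchange_eq:
  "create (a \<alpha>) (annih (a \<beta>) (create (b \<beta>) (annih (b \<alpha>) \<psi>)))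
    = create (a \<alpha>) (annih (a \<alpha>) (create (b \<beta>) (annih (b \<beta>) \<psi>)))
    + (if a \<beta> = b \<beta> then create (a \<alpha>) (annih (b \<alpha>) \<psi>) else 0)
    - (if a \<alpha> = b \<beta> then create (a \<alpha>) (annih (b \<beta>) \<psi>) else 0)
    + create (a \<alpha>) (create (b \<beta>) (swap_defect a b \<alpha> \<beta> \<psi>))"
  by (simp add: annih_create_eq create_diff swap_defect_def)

section \<open>Mode labels and particle numbers of the lattice model\<close>

abbreviation cmode :: "'v \<Rightarrow> 'n \<Rightarrow> ('v, 'n) mode" where
  "cmode x \<alpha> \<equiv> Inl (x, \<alpha>)"

abbreviation fmode :: "'v \<Rightarrow> 'n \<Rightarrow> ('v, 'n) mode" where
  "fmode x \<alpha> \<equiv> Inr (x, \<alpha>)"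

text \<open>Localized fermions are placed on a second copy of the lattice, so that the color
  operators become single sums over \<open>'v + 'v\<close>.\<close>

definition site_mode :: "'v + 'v \<Rightarrow> 'n \<Rightarrow> ('v, 'n) mode" where
  "site_mode s \<alpha> = map_sum (\<lambda>x. (x, \<alpha>)) (\<lambda>x. (x, \<alpha>)) s"

lemma site_mode_simps [simp]:
  "site_mode (Inl x) = cmode x" "site_mode (Inr x) = fmode x"
  by (auto simp: site_mode_def)

lemma site_mode_inject [simp]: "site_mode s \<alpha> = site_mode t \<beta> \<longleftrightarrow> s = t \<and> \<alpha> = \<beta>"
  by (cases s; cases t) auto

lemma sum_UNIV_sum_type: "(\<Sum>s\<in>UNIV. g s) = (\<Sum>x\<in>UNIV. g (Inl x)) + (\<Sum>y\<in>UNIV. g (Inr y))"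
  for g :: "'a::finite + 'b::finite \<Rightarrow> 'c::comm_monoid_add"
  by (simp add: sum.Plus flip: UNIV_Plus_UNIV)

lemma F_tot_site_mode:
  "F_tot \<alpha> \<beta> \<psi> = (\<Sum>s\<in>UNIV. create (site_mode s \<alpha>) (annih (site_mode s \<beta>) \<psi>))"
  by (simp add: F_tot_def cdag_def cop_def fdag_def fop_def sum.distrib sum_UNIV_sum_type)

lemma nf_op_num_op: "nf_op x \<psi> = num_op (range (fmode x)) \<psi>"
  by (simp add: nf_op_def num_op_def fdag_def fop_def sum.reindex inj_def)

lemma num_op_cmode: "num_op (modes cmode) \<psi> = (\<Sum>x\<in>UNIV. \<Sum>\<alpha>\<in>UNIV. create (cmode x \<alpha>) (annih (cmode x \<alpha>) \<psi>))"
  for \<psi> :: "('v::finite, 'n::finite) kstate"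
proof -
  have "modes (cmode :: 'v \<Rightarrow> 'n \<Rightarrow> ('v, 'n) mode) = (\<lambda>p. Inl p) ` (UNIV \<times> UNIV)"
    by (auto simp: modes_def)
  then show ?thesis
    by (simp add: num_op_def sum.reindex sum.cartesian_product case_prod_beta)
qed

lemma N_tot_eq: "N_tot \<psi> = num_op (modes cmode) \<psi> + (\<Sum>x\<in>UNIV. nf_op x \<psi>)"
  for \<psi> :: "('v::finite, 'n::finite) kstate"
  unfolding N_tot_def F_tot_def num_op_cmode nf_op_def sum.distrib cdag_def cop_def fdag_def fop_def
  by (subst sum.swap, subst (2) sum.swap) (rule refl)

lemma N_tot_site_mode:
  "N_tot \<psi> = (\<Sum>s\<in>UNIV. \<Sum>\<alpha>\<in>UNIV. create (site_mode s \<alpha>) (annih (site_mode s \<alpha>) \<psi>))"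
  unfolding N_tot_def F_tot_site_mode by (rule sum.swap)

lemma W_H_space_num_c:
  fixes \<psi> :: "('v::finite, 'n::finite) kstate"
  assumes "\<psi> \<in> W_space"
  shows "\<psi> \<in> H_space (d + CARD('v)) \<longleftrightarrow> num_op (modes cmode) \<psi> = of_nat d *s \<psi>"
proof -
  have "(\<Sum>x\<in>(UNIV :: 'v set). nf_op x \<psi>) = of_nat CARD('v) *s \<psi>"
    using assms by (simp add: W_space_def vec_eq_iff)
  then show ?thesis
    by (simp add: H_space_def N_tot_eq vec.scale_left_distrib)
qed

section \<open>The Casimir operator\<close>

text \<open>The remainder of a color exchange after the number operators are split off. Being
  negative semidefinite, it measures both the distance from minimal energy for \<open>J < 0\<close>
  and from the maximal Casimir value.\<close>

definition defect_op :: "('n::finite \<Rightarrow> 'm::finite) \<Rightarrow> ('n \<Rightarrow> 'm) \<Rightarrow> 'm fock \<Rightarrow> 'm fock" where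
  "defect_op a b \<psi> = (\<Sum>\<alpha>\<in>UNIV. \<Sum>\<beta>\<in>UNIV. create (a \<alpha>) (create (b \<beta>) (swap_defect a b \<alpha> \<beta> \<psi>)))"

lemma defect_op_swap_sym: "swap_sym a b \<psi> \<Longrightarrow> defect_op a b \<psi> = 0"
  by (simp add: defect_op_def swap_sym_def)

lemma Re_cinner_defect_op:
  "Re (cinner \<psi> (defect_op a b \<psi>)) = - (1 / 2) * (\<Sum>\<alpha>\<in>UNIV. \<Sum>\<beta>\<in>UNIV.
     Re (cinner (swap_defect a b \<alpha> \<beta> \<psi>) (swap_defect a b \<alpha> \<beta> \<psi>)))"
  unfolding defect_op_def cinner_swap_defect_sum by simp

lemma Re_cinner_defect_op_nonpos: "Re (cinner \<psi> (defect_op a b \<psi>)) \<le> 0"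
  by (simp add: Re_cinner_defect_op sum_nonneg cinner_self_nonneg)

lemma Re_cinner_defect_op_eq_0D:
  assumes "Re (cinner \<psi> (defect_op a b \<psi>)) = 0"
  shows "swap_sym a b \<psi>"
proof -
  have "(\<Sum>\<alpha>\<in>UNIV. \<Sum>\<beta>\<in>UNIV. Re (cinner (swap_defect a b \<alpha> \<beta> \<psi>) (swap_defect a b \<alpha> \<beta> \<psi>))) = 0"
    using assms by (simp add: Re_cinner_defect_op)
  then have "Re (cinner (swap_defect a b \<alpha> \<beta> \<psi>) (swap_defect a b \<alpha> \<beta> \<psi>)) = 0" for \<alpha> \<beta>
    by (simp add: sum_nonneg_eq_0_iff sum_nonneg cinner_self_nonneg)
  then show ?thesis
    by (simp add: swap_sym_def cinner_self_eq_0)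
qed

text \<open>In \<open>exchange_eq\<close> the first contraction occurs at equal sites for every
  second color, hence the factor \<open>CARD('n)\<close>; the second also requires equal colors and
  gives \<open>N_tot \<psi>\<close> once.\<close>

lemma F_tot_exchange_sum:
  fixes \<psi> :: "('v::finite, 'n::finite) kstate"
  shows "(\<Sum>\<alpha>\<in>UNIV. \<Sum>\<beta>\<in>UNIV. F_tot \<alpha> \<beta> (F_tot \<beta> \<alpha> \<psi>))
    = N_tot (N_tot \<psi>) + of_nat CARD('n) *s N_tot \<psi> - N_tot \<psi>
      + (\<Sum>s\<in>UNIV. \<Sum>t\<in>UNIV. defect_op (site_mode s) (site_mode t) \<psi>)"
proof -
  let ?U = "UNIV :: ('v + 'v) set" and ?C = "UNIV :: 'n set"
  let ?n = "\<lambda>s \<alpha>. create (site_mode s \<alpha>) (annih (site_mode s \<alpha>) \<psi>) :: ('v, 'n) kstate"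
  have "(\<Sum>\<alpha>\<in>?C. \<Sum>\<beta>\<in>?C. F_tot \<alpha> \<beta> (F_tot \<beta> \<alpha> \<psi>))
      = (\<Sum>\<alpha>\<in>?C. \<Sum>\<beta>\<in>?C. \<Sum>s\<in>?U. \<Sum>t\<in>?U. create (site_mode s \<alpha>) (annih (site_mode s \<beta>)
            (create (site_mode t \<beta>) (annih (site_mode t \<alpha>) \<psi>))))"
    by (simp add: F_tot_site_mode fock_linear)
  also have "\<dots> = (\<Sum>\<alpha>\<in>?C. \<Sum>\<beta>\<in>?C. \<Sum>s\<in>?U. \<Sum>t\<in>?U.
        create (site_mode s \<alpha>) (annih (site_mode s \<alpha>) (?n t \<beta>)))
      + (\<Sum>\<alpha>\<in>?C. \<Sum>\<beta>\<in>?C. \<Sum>s\<in>?U. \<Sum>t\<in>?U. if s = t then ?n s \<alpha> else 0)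
      - (\<Sum>\<alpha>\<in>?C. \<Sum>\<beta>\<in>?C. \<Sum>s\<in>?U. \<Sum>t\<in>?U. if \<beta> = \<alpha> then if s = t then ?n s \<alpha> else 0 else 0)
      + (\<Sum>\<alpha>\<in>?C. \<Sum>\<beta>\<in>?C. \<Sum>s\<in>?U. \<Sum>t\<in>?U.
          create (site_mode s \<alpha>) (create (site_mode t \<beta>) (swap_defect (site_mode s) (site_mode t) \<alpha> \<beta> \<psi>)))"
    unfolding sum.distrib[symmetric] sum_subtractf[symmetric]
    by (intro sum.cong refl, subst exchange_eq) auto
  also have "(\<Sum>\<alpha>\<in>?C. \<Sum>\<beta>\<in>?C. \<Sum>s\<in>?U. \<Sum>t\<in>?U.
        create (site_mode s \<alpha>) (annih (site_mode s \<alpha>) (?n t \<beta>))) = N_tot (N_tot \<psi>)"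
    unfolding N_tot_def F_tot_site_mode fock_linear
    by (intro sum.cong refl) (rule sum.swap)
  also have "(\<Sum>\<alpha>\<in>?C. \<Sum>\<beta>\<in>?C. \<Sum>s\<in>?U. \<Sum>t\<in>?U. if s = t then ?n s \<alpha> else 0)
      = of_nat CARD('n) *s N_tot \<psi>"
    unfolding N_tot_def F_tot_site_mode
    by (simp add: scale_sum vec_eq_iff sum_distrib_left of_nat_index)
  also have "(\<Sum>\<alpha>\<in>?C. \<Sum>\<beta>\<in>?C. \<Sum>s\<in>?U. \<Sum>t\<in>?U. if \<beta> = \<alpha> then if s = t then ?n s \<alpha> else 0 else 0)
      = N_tot \<psi>"
  proof -
    have "(\<Sum>\<beta>\<in>?C. \<Sum>s\<in>?U. \<Sum>t\<in>?U. if \<beta> = \<alpha> then if s = t then ?n s \<alpha> else 0 else 0)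
        = (\<Sum>\<beta>\<in>?C. if \<beta> = \<alpha> then \<Sum>s\<in>?U. ?n s \<alpha> else 0)" for \<alpha>
      by (intro sum.cong refl) simp
    then show ?thesis
      by (simp add: N_tot_def F_tot_site_mode)
  qed
  also have "(\<Sum>\<alpha>\<in>?C. \<Sum>\<beta>\<in>?C. \<Sum>s\<in>?U. \<Sum>t\<in>?U.
          create (site_mode s \<alpha>) (create (site_mode t \<beta>) (swap_defect (site_mode s) (site_mode t) \<alpha> \<beta> \<psi>)))
      = (\<Sum>s\<in>?U. \<Sum>t\<in>?U. defect_op (site_mode s) (site_mode t) \<psi>)"
    unfolding defect_op_def sum.cartesian_product by (rule sum.reindex_bij_witness[of _
        "\<lambda>(s, t, \<alpha>, \<beta>). (\<alpha>, \<beta>, s, t)" "\<lambda>(\<alpha>, \<beta>, s, t). (s, t, \<alpha>, \<beta>)"]) auto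
  finally show ?thesis .
qed

text \<open>Inserting the particle number leaves \<open>(n^2 + N * n - n - n^2 / N) / 2\<close>,
  which is \<open>max_casimir N n\<close>.\<close>

lemma casimir_tot_H_space:
  fixes \<psi> :: "('v::finite, 'n::finite) kstate"
  assumes "\<psi> \<in> H_space n"
  shows "casimir_tot \<psi> = complex_of_real (max_casimir CARD('n) n) *s \<psi>
    + (1 / 2) *s (\<Sum>s\<in>UNIV. \<Sum>t\<in>UNIV. defect_op (site_mode s) (site_mode t) \<psi>)"
proof -
  have N: "N_tot \<psi> = of_nat n *s \<psi>"
    using assms by (simp add: H_space_def)
  have "N_tot (of_nat n *s \<psi>) = of_nat n *s N_tot \<psi>"
    by (simp add: N_tot_site_mode fock_linear scale_sum)
  then have NN: "N_tot (of_nat n *s \<psi>) = of_nat n *s (of_nat n *s \<psi>)"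
    by (simp only: N)
  show ?thesis
    unfolding casimir_tot_def F_tot_exchange_sum N NN
    by (simp add: vec_eq_iff max_casimir_def field_simps)
qed

lemma casimir_tot_swap_sym:
  fixes \<psi> :: "('v::finite, 'n::finite) kstate"
  assumes "\<psi> \<in> H_space n" "\<And>s t. swap_sym (site_mode s) (site_mode t) \<psi>"
  shows "casimir_tot \<psi> = complex_of_real (max_casimir CARD('n) n) *s \<psi>"
  using assms by (simp add: casimir_tot_H_space defect_op_swap_sym)

lemma casimir_tot_eigval_le:
  fixes \<psi> :: "('v::finite, 'n::finite) kstate"
  assumes "eigvec_in casimir_tot (H_space n) e \<psi>"
  shows "e \<le> max_casimir CARD('n) n"
proof -
  have \<psi>: "\<psi> \<in> H_space n" "\<psi> \<noteq> 0" "casimir_tot \<psi> = complex_of_real e *s \<psi>"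
    using assms by (auto simp: eigvec_in_def)
  have pos: "0 < Re (cinner \<psi> \<psi>)"
    using cinner_self_nonneg[of \<psi>] cinner_self_eq_0[of \<psi>] \<psi>(2) by linarith
  have "e * Re (cinner \<psi> \<psi>) = Re (cinner \<psi> (casimir_tot \<psi>))"
    by (simp add: \<psi>(3) cinner_scale_right)
  also have "\<dots> = max_casimir CARD('n) n * Re (cinner \<psi> \<psi>)
      + 1 / 2 * (\<Sum>s\<in>UNIV. \<Sum>t\<in>UNIV. Re (cinner \<psi> (defect_op (site_mode s) (site_mode t) \<psi>)))"
    by (simp add: casimir_tot_H_space[OF \<psi>(1)] cinner_add_right cinner_scale_right cinner_sum_right)
  also have "\<dots> \<le> max_casimir CARD('n) n * Re (cinner \<psi> \<psi>)"
    by (simp add: sum_nonpos Re_cinner_defect_op_nonpos)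
  finally show ?thesis
    using pos by simp
qed

section \<open>The Kondo Hamiltonian\<close>

text \<open>The completeness relation contracts the sum over generators into a color exchange minus
  \<open>1 / N\<close> times the product of the two number operators at \<open>x\<close>.\<close>

lemma spin_coupling_eq:
  fixes G :: "nat \<Rightarrow> complex^'n::finite^'n" and \<psi> :: "('v::finite, 'n) kstate"
  assumes G: "su_generators G"
  shows "(\<Sum>A = 1..CARD('n)^2 - 1. s_op G A x (S_op G A x \<psi>))
    = (\<Sum>\<alpha>\<in>UNIV. \<Sum>\<beta>\<in>UNIV. create (cmode x \<alpha>) (annih (cmode x \<beta>)
          (create (fmode x \<beta>) (annih (fmode x \<alpha>) \<psi>))))
      - (1 / of_nat CARD('n)) *s (\<Sum>\<alpha>\<in>UNIV. create (cmode x \<alpha>) (annih (cmode x \<alpha>) (nf_op x \<psi>)))"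
proof -
  let ?C = "UNIV :: 'n set" and ?N = "of_nat CARD('n) :: complex"
  define X where "X \<alpha> \<beta> \<mu> \<nu> = create (cmode x \<alpha>) (annih (cmode x \<beta>)
      (create (fmode x \<mu>) (annih (fmode x \<nu>) \<psi>)))" for \<alpha> \<beta> \<mu> \<nu>
  have scale_diff_if: "((if P then 1 else 0) - (if Q then r else 0)) *s v
      = (if P then v else 0) - (if Q then r *s v else 0)" for P Q r and v :: "('v, 'n) kstate"
    by (cases P; cases Q) (simp_all add: vec.scale_left_diff_distrib)
  have "(\<Sum>A = 1..CARD('n)^2 - 1. s_op G A x (S_op G A x \<psi>))
      = (\<Sum>A = 1..CARD('n)^2 - 1. \<Sum>\<alpha>\<in>?C. \<Sum>\<beta>\<in>?C. \<Sum>\<mu>\<in>?C. \<Sum>\<nu>\<in>?C.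
          (G A $ \<alpha> $ \<beta> * G A $ \<mu> $ \<nu>) *s X \<alpha> \<beta> \<mu> \<nu>)"
    by (simp add: s_op_def S_op_def cdag_def cop_def fdag_def fop_def fock_linear scale_sum X_def)
  also have "\<dots> = (\<Sum>\<alpha>\<in>?C. \<Sum>\<beta>\<in>?C. \<Sum>\<mu>\<in>?C. \<Sum>\<nu>\<in>?C. \<Sum>A = 1..CARD('n)^2 - 1.
          (G A $ \<alpha> $ \<beta> * G A $ \<mu> $ \<nu>) *s X \<alpha> \<beta> \<mu> \<nu>)"
    by (subst sum.swap, intro sum.cong refl)+
  also have "\<dots> = (\<Sum>\<alpha>\<in>?C. \<Sum>\<beta>\<in>?C. \<Sum>\<mu>\<in>?C. \<Sum>\<nu>\<in>?C.
          (if \<alpha> = \<nu> \<and> \<beta> = \<mu> then X \<alpha> \<beta> \<mu> \<nu> else 0)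
        - (if \<alpha> = \<beta> \<and> \<mu> = \<nu> then (1 / ?N) *s X \<alpha> \<beta> \<mu> \<nu> else 0))"
    unfolding vec.scale_sum_left[symmetric] su_generators_complete[OF G]
    by (intro sum.cong refl scale_diff_if)
  also have "\<dots> = (\<Sum>\<alpha>\<in>?C. \<Sum>\<beta>\<in>?C. X \<alpha> \<beta> \<beta> \<alpha>)
      - (\<Sum>\<alpha>\<in>?C. \<Sum>\<mu>\<in>?C. (1 / ?N) *s X \<alpha> \<alpha> \<mu> \<mu>)"
  proof -
    have 1: "(\<Sum>\<mu>\<in>?C. \<Sum>\<nu>\<in>?C. if \<alpha> = \<nu> \<and> \<beta> = \<mu> then X \<alpha> \<beta> \<mu> \<nu> else 0) = X \<alpha> \<beta> \<beta> \<alpha>" for \<alpha> \<beta>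
    proof -
      have "(\<Sum>\<mu>\<in>?C. \<Sum>\<nu>\<in>?C. if \<alpha> = \<nu> \<and> \<beta> = \<mu> then X \<alpha> \<beta> \<mu> \<nu> else 0)
          = (\<Sum>\<mu>\<in>?C. if \<beta> = \<mu> then X \<alpha> \<beta> \<mu> \<alpha> else 0)"
        by (intro sum.cong refl) simp
      then show ?thesis by simp
    qed
    have 2: "(\<Sum>\<beta>\<in>?C. \<Sum>\<mu>\<in>?C. \<Sum>\<nu>\<in>?C. if \<alpha> = \<beta> \<and> \<mu> = \<nu> then (1 / ?N) *s X \<alpha> \<beta> \<mu> \<nu> else 0)
        = (\<Sum>\<mu>\<in>?C. (1 / ?N) *s X \<alpha> \<alpha> \<mu> \<mu>)" for \<alpha>
    proof -
      have "(\<Sum>\<beta>\<in>?C. \<Sum>\<mu>\<in>?C. \<Sum>\<nu>\<in>?C. if \<alpha> = \<beta> \<and> \<mu> = \<nu> then (1 / ?N) *s X \<alpha> \<beta> \<mu> \<nu> else 0)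
          = (\<Sum>\<beta>\<in>?C. if \<alpha> = \<beta> then \<Sum>\<mu>\<in>?C. (1 / ?N) *s X \<alpha> \<beta> \<mu> \<mu> else 0)"
        by (intro sum.cong refl) simp
      then show ?thesis by simp
    qed
    show ?thesis
      by (simp only: sum_subtractf 1 2)
  qed
  also have "(\<Sum>\<alpha>\<in>?C. \<Sum>\<mu>\<in>?C. (1 / ?N) *s X \<alpha> \<alpha> \<mu> \<mu>)
      = (1 / ?N) *s (\<Sum>\<alpha>\<in>?C. create (cmode x \<alpha>) (annih (cmode x \<alpha>) (nf_op x \<psi>)))"
    by (simp add: X_def nf_op_def fdag_def fop_def fock_linear scale_sum)
  finally show ?thesis
    by (simp only: X_def)
qed

text \<open>Itinerant and localized modes never coincide, so no contraction appears. With one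
  localized fermion per site the number products reduce to the itinerant number, with weight 1 from
  the exchange and \<open>- 1 / N\<close> from the trace part.\<close>

lemma H_KLM_W_space:
  fixes G :: "nat \<Rightarrow> complex^'n::finite^'n" and \<psi> :: "('v::finite, 'n) kstate"
  assumes G: "su_generators G" and W: "\<psi> \<in> W_space"
  shows "H_KLM T J G \<psi> =
      (\<Sum>\<alpha>\<in>UNIV. \<Sum>x\<in>UNIV. \<Sum>y\<in>UNIV. T $ x $ y *s create (cmode x \<alpha>) (annih (cmode y \<alpha>) \<psi>))
      + complex_of_real (J * (1 - 1 / real CARD('n))) *s num_op (modes cmode) \<psi>
      + complex_of_real J *s (\<Sum>x\<in>UNIV. defect_op (cmode x) (fmode x) \<psi>)"
proof -
  have nf: "nf_op x \<psi> = \<psi>" for x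
    using W by (simp add: W_space_def)
  have "(\<Sum>\<alpha>\<in>UNIV. \<Sum>\<beta>\<in>UNIV. create (cmode x \<alpha>) (annih (cmode x \<beta>)
          (create (fmode x \<beta>) (annih (fmode x \<alpha>) \<psi>))))
      = (\<Sum>\<alpha>\<in>UNIV. create (cmode x \<alpha>) (annih (cmode x \<alpha>) (nf_op x \<psi>))) + defect_op (cmode x) (fmode x) \<psi>"
    for x
    unfolding defect_op_def nf_op_def fdag_def fop_def fock_linear sum.distrib[symmetric]
    by (intro sum.cong refl, subst exchange_eq) simp
  then have "(\<Sum>x\<in>UNIV. \<Sum>A = 1..CARD('n)^2 - 1. s_op G A x (S_op G A x \<psi>))
      = complex_of_real (1 - 1 / real CARD('n)) *s num_op (modes cmode) \<psi>
        + (\<Sum>x\<in>UNIV. defect_op (cmode x) (fmode x) \<psi>)"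
    unfolding spin_coupling_eq[OF G]
    by (simp add: nf num_op_cmode vec.scale_left_diff_distrib
        sum.distrib sum_subtractf scale_sum)
  then show ?thesis
    unfolding H_KLM_def cdag_def cop_def
    by (simp add: vec.scale_right_distrib vec.scale_left_diff_distrib right_diff_distrib)
qed

text \<open>The basis vectors in \<open>A\<close> are filled one after another with color
  \<open>\<alpha>0\<close>, on top of localized fermions of that color. The last clause carries the
  induction: it keeps the next vector free at its dual site.\<close>

lemma polarized_state_exists:
  fixes T :: "complex^'v::finite^'v" and \<alpha>0 :: "'n::finite"
  assumes ker: "\<And>z. z \<in> I \<Longrightarrow> \<mu> z \<in> mat_ker T"
    and dual: "\<And>z w. z \<in> I \<Longrightarrow> w \<in> I \<Longrightarrow> \<mu> z $ w = (if z = w then 1 else 0)"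
    and A: "finite A" "A \<subseteq> I"
  shows "\<exists>\<psi> :: ('v, 'n) kstate. \<psi> \<noteq> 0 \<and> num_op (modes cmode) \<psi> = of_nat (card A) *s \<psi> \<and>
    (\<forall>x. nf_op x \<psi> = \<psi>) \<and>
    (\<forall>x \<alpha>. \<alpha> \<noteq> \<alpha>0 \<longrightarrow> annih (cmode x \<alpha>) \<psi> = 0 \<and> annih (fmode x \<alpha>) \<psi> = 0) \<and>
    (\<forall>x \<alpha>. (\<Sum>y\<in>UNIV. T $ x $ y *s annih (cmode y \<alpha>) \<psi>) = 0) \<and>
    (\<forall>z\<in>I - A. annih (cmode z \<alpha>0) \<psi> = 0)"
  using A
proof (induction A rule: finite_induct)
  case empty
  define S where "S = range (\<lambda>x :: 'v. fmode x \<alpha>0)"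
  define \<psi> :: "('v, 'n) kstate" where "\<psi> = axis S 1"
  have kill: "annih m \<psi> = 0" if "m \<notin> S" for m
  proof -
    have "insert m R \<noteq> S" for R
      using that by blast
    then show ?thesis
      by (auto simp: \<psi>_def annih_def vec_eq_iff axis_def)
  qed
  have c: "annih (cmode x \<alpha>) \<psi> = 0" for x \<alpha>
    by (rule kill) (auto simp: S_def)
  have "\<psi> \<noteq> 0"
    by (simp add: \<psi>_def axis_eq_0_iff)
  moreover have "num_op (modes cmode) \<psi> = 0"
    by (simp add: num_op_cmode c)
  moreover have "nf_op x \<psi> = \<psi>" for x
  proof -
    have "nf_op x \<psi> $ R = \<psi> $ R" for R
    proof (cases "R = S")
      case True
      have "nf_op x \<psi> $ R = (\<Sum>\<alpha>\<in>(UNIV :: 'n set). if \<alpha> = \<alpha>0 then 1 else 0)"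
        unfolding nf_op_def fdag_def fop_def sum_component create_annih_nth True
        by (intro sum.cong refl) (auto simp: S_def \<psi>_def)
      then show ?thesis
        by (simp add: True \<psi>_def)
    next
      case False
      then have "\<psi> $ R = 0"
        by (simp add: \<psi>_def axis_def)
      then show ?thesis
        by (auto simp: nf_op_def fdag_def fop_def create_annih_nth intro!: sum.neutral)
    qed
    then show ?thesis
      by (simp add: vec_eq_iff)
  qed
  moreover have "annih (fmode x \<alpha>) \<psi> = 0" if "\<alpha> \<noteq> \<alpha>0" for x \<alpha>
    using that by (intro kill) (auto simp: S_def)
  ultimately show ?case
    using c by (intro exI[of _ \<psi>]) simp
next
  case (insert z A)
  then obtain \<psi> :: "('v, 'n) kstate" where \<psi>: "\<psi> \<noteq> 0" "num_op (modes cmode) \<psi> = of_nat (card A) *s \<psi>"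
      "\<And>x. nf_op x \<psi> = \<psi>"
      "\<And>x \<alpha>. \<alpha> \<noteq> \<alpha>0 \<Longrightarrow> annih (cmode x \<alpha>) \<psi> = 0" "\<And>x \<alpha>. \<alpha> \<noteq> \<alpha>0 \<Longrightarrow> annih (fmode x \<alpha>) \<psi> = 0"
      "\<And>x \<alpha>. (\<Sum>y\<in>UNIV. T $ x $ y *s annih (cmode y \<alpha>) \<psi>) = 0"
      "\<And>w. w \<in> I - A \<Longrightarrow> annih (cmode w \<alpha>0) \<psi> = 0"
    by auto
  have z: "z \<in> I"
    using insert.prems by simp
  define C :: "('v, 'n) kstate \<Rightarrow> ('v, 'n) kstate" where "C \<phi> = (\<Sum>x\<in>UNIV. \<mu> z $ x *s create (cmode x \<alpha>0) \<phi>)" for \<phi>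
  have C0: "C 0 = 0"
    by (simp add: C_def)
  have C_scale: "C (a *s \<phi>) = a *s C \<phi>" for a \<phi>
    by (simp add: C_def create_scale scale_sum mult.commute)
  have C_sum: "C (\<Sum>i\<in>X. g i) = (\<Sum>i\<in>X. C (g i))" for X and g :: "'v \<Rightarrow> ('v, 'n) kstate"
    unfolding C_def create_sum scale_sum by (rule sum.swap)
  have annih_c: "annih (cmode y \<alpha>) (C \<psi>) = (if \<alpha> = \<alpha>0 then \<mu> z $ y else 0) *s \<psi> - C (annih (cmode y \<alpha>) \<psi>)" for y \<alpha>
  proof -
    have "annih (cmode y \<alpha>) (C \<psi>) = (\<Sum>x\<in>UNIV. \<mu> z $ x *s (if y = x \<and> \<alpha> = \<alpha>0 then \<psi> else 0)) - C (annih (cmode y \<alpha>) \<psi>)"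
      by (simp add: C_def annih_sum annih_scale annih_create_eq vec.scale_right_diff_distrib sum_subtractf)
    also have "(\<Sum>x\<in>UNIV. \<mu> z $ x *s (if y = x \<and> \<alpha> = \<alpha>0 then \<psi> else 0))
        = (\<Sum>x\<in>UNIV. if y = x then (if \<alpha> = \<alpha>0 then \<mu> z $ x else 0) *s \<psi> else 0)"
      by (intro sum.cong refl) auto
    finally show ?thesis
      by simp
  qed
  have annih_f: "annih (fmode y \<alpha>) (C \<psi>) = - C (annih (fmode y \<alpha>) \<psi>)" for y \<alpha>
    by (simp add: C_def annih_sum annih_scale annih_create_eq sum_negf)
  \<comment> \<open>By duality, annihilating at \<open>z\<close> undoes \<open>C\<close>, which
    creates a fermion in the orbital \<open>\<mu> z\<close>; so the new state is nonzero.\<close>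
  have "annih (cmode z \<alpha>0) (C \<psi>) = \<psi>"
    using insert.hyps(2) z by (simp add: annih_c \<psi>(7) C0 dual)
  then have "C \<psi> \<noteq> 0"
    using \<psi>(1) by auto
  moreover have "num_op (modes cmode) (C \<psi>) = of_nat (card (insert z A)) *s C \<psi>"
  proof -
    have "num_op (modes cmode) (C \<psi>) = C (num_op (modes cmode) \<psi>) + C \<psi>"
      by (simp add: C_def num_op_sum num_op_scale num_op_create vec.scale_right_distrib sum.distrib
          mode_in_modes[of cmode])
    then show ?thesis
      using insert.hyps by (simp add: \<psi>(2) C_scale vec.scale_left_distrib add.commute)
  qed
  moreover have "nf_op x (C \<psi>) = C \<psi>" for x
  proof -
    have "nf_op x (C \<psi>) = C (nf_op x \<psi>)"
      by (simp add: nf_op_num_op C_def num_op_sum num_op_scale num_op_create image_iff)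
    then show ?thesis
      by (simp add: \<psi>(3))
  qed
  moreover have "(\<Sum>y\<in>UNIV. T $ x $ y *s annih (cmode y \<alpha>) (C \<psi>)) = 0" for x \<alpha>
  proof -
    have "(\<Sum>y\<in>UNIV. T $ x $ y * \<mu> z $ y) = 0"
      using ker[OF z] by (simp add: mat_ker_def matrix_vector_mult_def vec_eq_iff)
    then have 1: "(\<Sum>y\<in>UNIV. (T $ x $ y * (if \<alpha> = \<alpha>0 then \<mu> z $ y else 0)) *s \<psi>) = 0"
      by (cases "\<alpha> = \<alpha>0") (simp_all flip: vec.scale_sum_left)
    have "(\<Sum>y\<in>UNIV. T $ x $ y *s annih (cmode y \<alpha>) (C \<psi>))
        = (\<Sum>y\<in>UNIV. (T $ x $ y * (if \<alpha> = \<alpha>0 then \<mu> z $ y else 0)) *s \<psi>)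
          - C (\<Sum>y\<in>UNIV. T $ x $ y *s annih (cmode y \<alpha>) \<psi>)"
      unfolding annih_c C_sum C_scale sum_subtractf[symmetric]
      by (simp add: vec.scale_right_diff_distrib)
    then show ?thesis
      by (simp only: 1 \<psi>(6) C0 diff_zero)
  qed
  moreover have "annih (cmode w \<alpha>0) (C \<psi>) = 0" if "w \<in> I - insert z A" for w
    using that z by (auto simp: annih_c dual \<psi>(7) C0)
  ultimately show ?case
    by (intro exI[of _ "C \<psi>"]) (auto simp: annih_c annih_f \<psi>(4,5) C0)
qed

text \<open>In a fully polarized state in the kernel, the hopping and all defects vanish and only
  the constant remains.\<close>

lemma polarized_ground_energy:
  fixes T :: "complex^'v::finite^'v" and G :: "nat \<Rightarrow> complex^'n::finite^'n"
  assumes G: "su_generators G"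
    and ker: "\<And>z. z \<in> I \<Longrightarrow> \<mu> z \<in> mat_ker T"
    and dual: "\<And>z w. z \<in> I \<Longrightarrow> w \<in> I \<Longrightarrow> \<mu> z $ w = (if z = w then 1 else 0)"
  shows "\<exists>\<psi>. eigvec_in (H_KLM T J G) (W_space \<inter> H_space (card I + CARD('v)))
    (J * (1 - 1 / real CARD('n)) * real (card I)) \<psi>"
proof -
  \<comment> \<open>Here \<open>undefined\<close> stands for an arbitrary fixed color.\<close>
  obtain \<psi> :: "('v, 'n) kstate" where \<psi>: "\<psi> \<noteq> 0" "num_op (modes cmode) \<psi> = of_nat (card I) *s \<psi>"
      "\<And>x. nf_op x \<psi> = \<psi>"
      "\<And>x \<alpha>. \<alpha> \<noteq> undefined \<Longrightarrow> annih (cmode x \<alpha>) \<psi> = 0"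
      "\<And>x \<alpha>. \<alpha> \<noteq> undefined \<Longrightarrow> annih (fmode x \<alpha>) \<psi> = 0"
      "\<And>x \<alpha>. (\<Sum>y\<in>UNIV. T $ x $ y *s annih (cmode y \<alpha>) \<psi>) = 0"
    using polarized_state_exists[where I = I and A = I and \<mu> = \<mu> and T = T and ?\<alpha>0.0 = "undefined :: 'n",
        OF ker dual finite subset_refl] by blast
  have W: "\<psi> \<in> W_space"
    using \<psi>(3) by (simp add: W_space_def)
  have "swap_sym (cmode x) (fmode x) \<psi>" for x
  proof -
    have "annih (cmode x \<alpha>) (annih (fmode x \<beta>) \<psi>) = 0" if "\<alpha> \<noteq> undefined \<or> \<beta> \<noteq> undefined" for \<alpha> \<beta>
      using that \<psi>(4)[of \<alpha> x] \<psi>(5)[of \<beta> x] annih_swap[of "cmode x \<alpha>" "fmode x \<beta>" \<psi>] by auto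
    then have "swap_defect (cmode x) (fmode x) \<alpha> \<beta> \<psi> = 0" for \<alpha> \<beta>
      by (cases "\<alpha> = undefined \<and> \<beta> = undefined") (auto simp: swap_defect_def)
    then show ?thesis
      by (simp add: swap_sym_def)
  qed
  then have "defect_op (cmode x) (fmode x) \<psi> = 0" for x
    by (rule defect_op_swap_sym)
  moreover have "(\<Sum>y\<in>UNIV. T $ x $ y *s create (cmode x \<alpha>) (annih (cmode y \<alpha>) \<psi>))
      = create (cmode x \<alpha>) (\<Sum>y\<in>UNIV. T $ x $ y *s annih (cmode y \<alpha>) \<psi>)" for x \<alpha>
    by (simp add: fock_linear)
  ultimately have "H_KLM T J G \<psi> = complex_of_real (J * (1 - 1 / real CARD('n)) * real (card I)) *s \<psi>"
    by (simp add: H_KLM_W_space[OF G W] \<psi>(2,6))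
  then show ?thesis
    using W \<psi>(1,2) by (auto simp: eigvec_in_def W_H_space_num_c)
qed

text \<open>Above the constant of the polarized state, the kinetic energy and, as
  \<open>J < 0\<close>, the defect energy are both nonnegative. An energy not exceeding that
  constant forces every single contribution to vanish.\<close>

lemma ground_state_conditions:
  fixes T :: "complex^'v::finite^'v" and G :: "nat \<Rightarrow> complex^'n::finite^'n"
    and \<psi> :: "('v, 'n) kstate"
  assumes T: "pos_semidef T" and G: "su_generators G" and J: "J < 0"
    and \<psi>: "eigvec_in (H_KLM T J G) (W_space \<inter> H_space (d + CARD('v))) e \<psi>"
    and e: "e \<le> J * (1 - 1 / real CARD('n)) * real d"
  shows "(\<chi> x. annih (cmode x \<alpha>) \<psi> $ S) \<in> mat_ker T" and "swap_sym (cmode x) (fmode x) \<psi>"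
proof -
  have W: "\<psi> \<in> W_space" and num: "num_op (modes cmode) \<psi> = of_nat d *s \<psi>"
      and H: "H_KLM T J G \<psi> = complex_of_real e *s \<psi>"
    using \<psi> by (auto simp: eigvec_in_def W_H_space_num_c)
  define kin where "kin \<alpha> = Re (cinner \<psi> (\<Sum>x\<in>UNIV. \<Sum>y\<in>UNIV.
      T $ x $ y *s create (cmode x \<alpha>) (annih (cmode y \<alpha>) \<psi>)))" for \<alpha>
  define def where "def x = Re (cinner \<psi> (defect_op (cmode x) (fmode x) \<psi>))" for x
  have "e * Re (cinner \<psi> \<psi>) = Re (cinner \<psi> (H_KLM T J G \<psi>))"
    by (simp add: H cinner_scale_right)
  also have "\<dots> = (\<Sum>\<alpha>\<in>UNIV. kin \<alpha>) + J * (1 - 1 / real CARD('n)) * real d * Re (cinner \<psi> \<psi>)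
      + J * (\<Sum>x\<in>UNIV. def x)"
    unfolding H_KLM_W_space[OF G W] num kin_def def_def
    by (simp add: cinner_add_right cinner_scale_right cinner_sum_right del: of_real_mult of_real_diff)
  finally have "(\<Sum>\<alpha>\<in>UNIV. kin \<alpha>) + J * (\<Sum>x\<in>UNIV. def x) \<le> 0"
    using mult_right_mono[OF e cinner_self_nonneg[of \<psi>]] by simp
  moreover have kin: "0 \<le> kin \<alpha>" for \<alpha>
    unfolding kin_def by (rule kinetic_nonneg[OF T])
  then have "0 \<le> (\<Sum>\<alpha>\<in>UNIV. kin \<alpha>)"
    by (simp add: sum_nonneg)
  moreover have def: "def x \<le> 0" for x
    unfolding def_def by (rule Re_cinner_defect_op_nonpos)
  then have "(\<Sum>x\<in>UNIV. def x) \<le> 0"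
    by (simp add: sum_nonpos)
  then have "0 \<le> J * (\<Sum>x\<in>UNIV. def x)"
    using J by (simp add: mult_nonpos_nonpos)
  ultimately have "(\<Sum>\<alpha>\<in>UNIV. kin \<alpha>) = 0" "J * (\<Sum>x\<in>UNIV. def x) = 0"
    by linarith+
  then have "kin \<alpha> = 0" "(\<Sum>x\<in>UNIV. - def x) = 0" for \<alpha>
    using kin J by (simp_all add: sum_nonneg_eq_0_iff sum_negf)
  then show "(\<chi> x. annih (cmode x \<alpha>) \<psi> $ S) \<in> mat_ker T"
    unfolding kin_def by (intro kinetic_eq_0D[OF T])
  have "def x = 0"
    using \<open>(\<Sum>x\<in>UNIV. - def x) = 0\<close> def by (subst (asm) sum_nonneg_eq_0_iff) auto
  then show "swap_sym (cmode x) (fmode x) \<psi>"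
    unfolding def_def by (rule Re_cinner_defect_op_eq_0D)
qed

theorem theorem2:
  fixes T P0 :: "complex^'v::finite^'v"
    and J :: real
    and G :: "nat \<Rightarrow> complex^'n::finite^'n"
    and D0 :: nat
  assumes "CARD('n) \<ge> 2"
    and "pos_semidef T"
    and "D0 = vec.dim (mat_ker T)"
    and "D0 > 0"
    and "orth_projection_onto P0 (mat_ker T)"
    and "su_generators G"
    and "J < 0"
    and "diag_support P0 = UNIV"
    and "irreducible_on P0 (diag_support P0)"
  shows "su_ferromagnetism T J G (D0 + CARD('v))"
  unfolding su_ferromagnetism_def
proof (intro allI impI)
  fix \<psi> :: "('v, 'n) kstate"
  assume gs: "ground_state T J G (D0 + CARD('v)) \<psi>"
  obtain I \<mu> where cI: "card I = vec.dim (mat_ker T)"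
    and ker: "\<And>z. z \<in> I \<Longrightarrow> \<mu> z \<in> mat_ker T"
    and dual: "\<And>z w. z \<in> I \<Longrightarrow> w \<in> I \<Longrightarrow> \<mu> z $ w = (if z = w then 1 else 0)"
    and expand: "\<And>v. v \<in> mat_ker T \<Longrightarrow> v = (\<Sum>z\<in>I. v $ z *s \<mu> z)"
    using orth_projection_local_basis[OF assms(5)] by blast
  have D0: "D0 = card I"
    using assms(3) cI by simp
  obtain e where e: "lowest_eigval_in (H_KLM T J G) (W_space \<inter> H_space (card I + CARD('v))) e"
    and \<psi>: "eigvec_in (H_KLM T J G) (W_space \<inter> H_space (card I + CARD('v))) e \<psi>"
    using gs by (auto simp: ground_state_def D0)
  have "e \<le> J * (1 - 1 / real CARD('n)) * real (card I)"
    using e polarized_ground_energy[OF assms(6) ker dual, of I J] by (auto simp: lowest_eigval_in_def)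
  note conds = ground_state_conditions[OF assms(2,6,7) \<psi> this]
  have W: "\<psi> \<in> W_space" and space: "\<psi> \<in> H_space (card I + CARD('v))" and "\<psi> \<noteq> 0"
    using \<psi> by (auto simp: eigvec_in_def)
  have cc0: "annih (cmode x \<alpha>) (annih (cmode x \<beta>) \<psi>) = 0" for x \<alpha> \<beta>
    by (rule hardcore_of_swap_sym[OF conds(2)[of x]])
      (use W in \<open>auto simp: W_space_def simp flip: nf_op_num_op\<close>)
  interpret local_swap_state cmode fmode I \<mu> \<psi>
  proof
    show "modes cmode \<inter> modes fmode = ({} :: ('v, 'n) mode set)"
      by (auto simp: modes_def)
    \<comment> \<open>For fixed \<open>S\<close> the amplitudes over \<open>x\<close> form a vector
      of \<open>mat_ker T\<close>, whose expansion in \<open>\<mu>\<close> is read off at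
      \<open>x\<close>.\<close>
    have "annih (cmode x \<gamma>) \<psi> $ S = (\<Sum>z\<in>I. \<mu> z $ x *s annih (cmode z \<gamma>) \<psi>) $ S" for x \<gamma> S
      using expand[OF conds(1)[of \<gamma> S], THEN arg_cong[where f = "\<lambda>v. v $ x"]]
      by (simp add: mult.commute)
    then have "annih (cmode x \<gamma>) \<psi> = (\<Sum>z\<in>I. \<mu> z $ x *s annih (cmode z \<gamma>) \<psi>)" for x \<gamma>
      unfolding vec_eq_iff by blast
    then show "hardcore cmode I \<mu> \<psi>"
      using cc0 unfolding hardcore_def by blast
    show "num_op (modes cmode) \<psi> = of_nat (card I) *s \<psi>"
      using W_H_space_num_c[OF W] space by simp
    show "I \<noteq> {}"
      using assms(4) D0 by auto
    show "\<exists>z\<in>I. \<mu> z $ x \<noteq> 0" for x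
    proof (rule ccontr)
      assume "\<not> (\<exists>z\<in>I. \<mu> z $ x \<noteq> 0)"
      then have "column x P0 $ x = 0"
        using expand[OF orth_projection_column[OF assms(5)], of x, THEN arg_cong[where f = "\<lambda>v. v $ x"]]
        by simp
      then show False
        using assms(8) by (auto simp: column_def diag_support_def)
    qed
    fix K assume K: "K \<subseteq> I" "K \<noteq> {}"
      "\<And>z w x. z \<in> K \<Longrightarrow> w \<in> I \<Longrightarrow> \<mu> z $ x \<noteq> 0 \<Longrightarrow> \<mu> w $ x \<noteq> 0 \<Longrightarrow> w \<in> K"
    have nz: "\<mu> z \<noteq> 0" if "z \<in> I" for z
      using dual[OF that that] by auto
    show "K = I"
      by (rule irreducible_connected[OF assms(5) assms(9)[unfolded assms(8)] assms(8)])
        (assumption | rule ker nz expand K)+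
  qed (use cc0 conds(2) in auto)
  have "swap_sym (site_mode s) (site_mode t) \<psi>" for s t :: "'v + 'v"
    by (cases s; cases t) (auto simp: cc_sym cf_sym ff_sym swap_sym_commute[of "fmode _" "cmode _"])
  then have cas: "casimir_tot \<psi> = complex_of_real (max_casimir CARD('n) (D0 + CARD('v))) *s \<psi>"
    using space by (intro casimir_tot_swap_sym) (simp_all add: D0)
  \<comment> \<open>The state \<open>\<psi>\<close> itself attains the value, so the general upper
    bound makes it the highest eigenvalue.\<close>
  then have "eigvec_in casimir_tot (H_space (D0 + CARD('v))) (max_casimir CARD('n) (D0 + CARD('v))) \<psi>"
    using space \<open>\<psi> \<noteq> 0\<close> by (simp add: eigvec_in_def D0)
  then show "highest_eigval_in (casimir_tot :: ('v, 'n) kop) (H_space (D0 + CARD('v)))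
        (max_casimir CARD('n) (D0 + CARD('v))) \<and>
      casimir_tot \<psi> = complex_of_real (max_casimir CARD('n) (D0 + CARD('v))) *s \<psi>"
    using cas casimir_tot_eigval_le by (auto simp: highest_eigval_in_def)
qed

end
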